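(* Let $(X,T)$ be a dynamical system without isolated points. If $(X,T)$ has one of the following properties, then it is densely uniformly chaotic: (1) $(X,T)$ is transitive and has a fixed point; (2) $(X,T)$ is totally transitive with a periodic point; (3) $(X,T)$ is scattering; (4) $(X,T)$ is weakly scattering with an equicontinuous minimal subset; (5) $(X,T)$ is weakly mixing. Finally: (6) If $(X,T)$ is transitive and has a periodic point of order $d$, then there is a closed $T^d$-invariant subset $X_0\subseteq X$ such that $(X_0,T^d)$ is densely uniformly chaotic and $X=\bigcup_{j=0}^{d-1}T^jX_0$. In particular $(X,T)$ is uniformly chaotic.
   Context: A dynamical system (TDS) $(X,T)$ is a nonempty compact metric space $(X,d)$ with a continuous surjective map $T:X\to X$. It is (topologically) transitive if for all nonempty open $U,V\subseteq X$ there is $n\in\mathbb Z_+$ with $U\cap T^{-n}V\neq\emptyset$; it is weakly mixing if $(X\times X,T\times T)$ is transitive. A system is minimal if it has no proper subsystem (nonempty closed invariant proper subset); a minimal subset of $X$ is a subset defining a minimal subsystem. A system is equicontinuous if for every $\epsilon>0$ there is $\delta>0$ such that $d(x,y)<\delta$ implies $d(T^nx,T^ny)<\epsilon$ for all $n\in\mathbb Z_+$. Two systems are weakly disjoint if their product is transitive. $(X,T)$ is scattering if it is weakly disjoint from every minimal system; weakly scattering if it is weakly disjoint from every minimal equicontinuous system; totally transitive if it is weakly disjoint from every periodic system (a system consisting of a single finite periodic orbit), equivalently, $(X,T^n)$ is transitive for all $n\ge1$. A subset $K\subseteq X$ is rigid if there is a sequence $n_k\nearrow+\infty$ with $\lim_k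 T^{n_k}x=x$ for every $x\in K$. It is uniformly rigid if for every $\epsilon>0$ there is an integer $n\ge 1$ with $d(T^nx,x)<\epsilon$ for all $x\in K$. It is uniformly proximal if for every $\epsilon>0$ there is $n\in\mathbb Z_+$ with $\mathrm{diam}\,T^nK<\epsilon$. It is proximal if every finite subset of $K$ is uniformly proximal. A subset $K\subseteq X$ is a uniformly chaotic set if there are Cantor sets $C_1\subseteq C_2\subseteq\cdots$ such that $K=\bigcup_{n}C_n$ is a rigid and a proximal subset of $X$, and each $C_N$ is uniformly rigid and uniformly proximal. $(X,T)$ is (densely) uniformly chaotic if it has a (dense) uniformly chaotic subset. *)

theory Defs
  imports "HOL-Analysis.Analysis"
begin

text \<open>
  A system is a pair of a carrier set \<open>X\<close> in a metric space type and a total function \<open>T\<close>, of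
  which only the values on \<open>X\<close> matter.  Open sets, continuity etc. are relative to \<open>X\<close>.
\<close>

definition tds :: "'a::metric_space set \<Rightarrow> ('a \<Rightarrow> 'a) \<Rightarrow> bool" where
  "tds X T \<longleftrightarrow> X \<noteq> {} \<and> compact X \<and> continuous_on X T \<and> T ` X = X"

definition no_isolated_points :: "'a::topological_space set \<Rightarrow> bool" where
  "no_isolated_points X \<longleftrightarrow> (\<forall>x\<in>X. x islimpt X)"

definition transitive :: "'a::topological_space set \<Rightarrow> ('a \<Rightarrow> 'a) \<Rightarrow> bool" where
  "transitive X T \<longleftrightarrow>
     (\<forall>U V. openin (top_of_set X) U \<and> U \<noteq> {} \<and> openin (top_of_set X) V \<and> V \<noteq> {} \<longrightarrow>
        (\<exists>n::nat. U \<inter> (T ^^ n) -` V \<noteq> {}))"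

definition minimal_system :: "'a::metric_space set \<Rightarrow> ('a \<Rightarrow> 'a) \<Rightarrow> bool" where
  "minimal_system X T \<longleftrightarrow>
     tds X T \<and> (\<forall>M. M \<noteq> {} \<and> closed M \<and> M \<subseteq> X \<and> T ` M \<subseteq> M \<longrightarrow> M = X)"

definition minimal_subset :: "'a::metric_space set \<Rightarrow> ('a \<Rightarrow> 'a) \<Rightarrow> 'a set \<Rightarrow> bool" where
  "minimal_subset X T M \<longleftrightarrow> M \<subseteq> X \<and> minimal_system M T"

definition equicontinuous :: "'a::metric_space set \<Rightarrow> ('a \<Rightarrow> 'a) \<Rightarrow> bool" where
  "equicontinuous X T \<longleftrightarrow>
     (\<forall>\<epsilon>>0. \<exists>\<delta>>0. \<forall>x\<in>X. \<forall>y\<in>X. dist x y < \<delta> \<longrightarrow> (\<forall>n::nat. dist ((T ^^ n) x) ((T ^^ n) y) < \<epsilon>))"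

definition periodic_system :: "'a::metric_space set \<Rightarrow> ('a \<Rightarrow> 'a) \<Rightarrow> bool" where
  "periodic_system X T \<longleftrightarrow>
     tds X T \<and> (\<exists>x\<in>X. (\<exists>n\<ge>1. (T ^^ n) x = x) \<and> X = range (\<lambda>k. (T ^^ k) x))"

definition has_fixed_point :: "'a set \<Rightarrow> ('a \<Rightarrow> 'a) \<Rightarrow> bool" where
  "has_fixed_point X T \<longleftrightarrow> (\<exists>x\<in>X. T x = x)"

definition has_periodic_point :: "'a set \<Rightarrow> ('a \<Rightarrow> 'a) \<Rightarrow> bool" where
  "has_periodic_point X T \<longleftrightarrow> (\<exists>x\<in>X. \<exists>n\<ge>1. (T ^^ n) x = x)"

text \<open>The order of a periodic point is its least period.\<close>

definition has_periodic_point_of_order :: "'a set \<Rightarrow> ('a \<Rightarrow> 'a) \<Rightarrow> nat \<Rightarrow> bool" where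
  "has_periodic_point_of_order X T d \<longleftrightarrow>
     d \<ge> 1 \<and> (\<exists>x\<in>X. (T ^^ d) x = x \<and> (\<forall>k. 0 < k \<and> k < d \<longrightarrow> (T ^^ k) x \<noteq> x))"

definition weakly_disjoint ::
  "'a::metric_space set \<Rightarrow> ('a \<Rightarrow> 'a) \<Rightarrow> 'b::metric_space set \<Rightarrow> ('b \<Rightarrow> 'b) \<Rightarrow> bool" where
  "weakly_disjoint X T Y S \<longleftrightarrow> transitive (X \<times> Y) (map_prod T S)"

definition weakly_mixing :: "'a::metric_space set \<Rightarrow> ('a \<Rightarrow> 'a) \<Rightarrow> bool" where
  "weakly_mixing X T \<longleftrightarrow> transitive (X \<times> X) (map_prod T T)"

text \<open>
  HOL cannot quantify over all metric space types inside a formula.  Since every compact metric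
  space is homeomorphic to a compact subset of \<open>\<nat> \<Rightarrow> \<real>\<close> (with the product topology), the test
  systems in the next three definitions are taken there.  The lemmas \<open>scattering_weakly_disjoint\<close>,
  \<open>weakly_scattering_weakly_disjoint\<close> and \<open>totally_transitive_weakly_disjoint\<close> below show that
  weak disjointness from the corresponding systems in an arbitrary metric space type follows.
\<close>

definition scattering :: "'a::metric_space set \<Rightarrow> ('a \<Rightarrow> 'a) \<Rightarrow> bool" where
  "scattering X T \<longleftrightarrow>
     (\<forall>(Y :: (nat \<Rightarrow> real) set) S. minimal_system Y S \<longrightarrow> weakly_disjoint X T Y S)"

definition weakly_scattering :: "'a::metric_space set \<Rightarrow> ('a \<Rightarrow> 'a) \<Rightarrow> bool" where
  "weakly_scattering X T \<longleftrightarrow>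
     (\<forall>(Y :: (nat \<Rightarrow> real) set) S.
        minimal_system Y S \<and> equicontinuous Y S \<longrightarrow> weakly_disjoint X T Y S)"

definition totally_transitive :: "'a::metric_space set \<Rightarrow> ('a \<Rightarrow> 'a) \<Rightarrow> bool" where
  "totally_transitive X T \<longleftrightarrow>
     (\<forall>(Y :: (nat \<Rightarrow> real) set) S. periodic_system Y S \<longrightarrow> weakly_disjoint X T Y S)"

definition rigid :: "('a::metric_space \<Rightarrow> 'a) \<Rightarrow> 'a set \<Rightarrow> bool" where
  "rigid T K \<longleftrightarrow>
     (\<exists>n :: nat \<Rightarrow> nat. strict_mono n \<and> (\<forall>x\<in>K. (\<lambda>k. (T ^^ n k) x) \<longlonglongrightarrow> x))"

definition uniformly_rigid :: "('a::metric_space \<Rightarrow> 'a) \<Rightarrow> 'a set \<Rightarrow> bool" where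
  "uniformly_rigid T K \<longleftrightarrow> (\<forall>\<epsilon>>0. \<exists>n\<ge>1. \<forall>x\<in>K. dist ((T ^^ n) x) x < \<epsilon>)"

definition uniformly_proximal :: "('a::metric_space \<Rightarrow> 'a) \<Rightarrow> 'a set \<Rightarrow> bool" where
  "uniformly_proximal T K \<longleftrightarrow> (\<forall>\<epsilon>>0. \<exists>n::nat. diameter ((T ^^ n) ` K) < \<epsilon>)"

definition proximal :: "('a::metric_space \<Rightarrow> 'a) \<Rightarrow> 'a set \<Rightarrow> bool" where
  "proximal T K \<longleftrightarrow> (\<forall>F. finite F \<and> F \<subseteq> K \<longrightarrow> uniformly_proximal T F)"

text \<open>The type of binary sequences carries the product topology of discrete two-point spaces.\<close>

definition cantor_set :: "'a::topological_space set \<Rightarrow> bool" where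
  "cantor_set C \<longleftrightarrow> C homeomorphic (UNIV :: (nat \<Rightarrow> bool) set)"

definition uniformly_chaotic_set :: "'a::metric_space set \<Rightarrow> ('a \<Rightarrow> 'a) \<Rightarrow> 'a set \<Rightarrow> bool" where
  "uniformly_chaotic_set X T K \<longleftrightarrow>
     K \<subseteq> X \<and>
     (\<exists>C :: nat \<Rightarrow> 'a set.
        (\<forall>N. cantor_set (C N)) \<and> (\<forall>N. C N \<subseteq> C (Suc N)) \<and> K = (\<Union>N. C N) \<and>
        rigid T K \<and> proximal T K \<and>
        (\<forall>N. uniformly_rigid T (C N) \<and> uniformly_proximal T (C N)))"

definition uniformly_chaotic :: "'a::metric_space set \<Rightarrow> ('a \<Rightarrow> 'a) \<Rightarrow> bool" where
  "uniformly_chaotic X T \<longleftrightarrow> (\<exists>K. uniformly_chaotic_set X T K)"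

definition densely_uniformly_chaotic :: "'a::metric_space set \<Rightarrow> ('a \<Rightarrow> 'a) \<Rightarrow> bool" where
  "densely_uniformly_chaotic X T \<longleftrightarrow> (\<exists>K. uniformly_chaotic_set X T K \<and> X \<subseteq> closure K)"


subsection \<open>Independence of the universal type\<close>

lemma funpow_in:
  assumes "f ` A \<subseteq> A" "a \<in> A"
  shows "(f ^^ n) a \<in> A"
  using assms by (induction n) auto

lemma funpow_conj:
  assumes "f ` A \<subseteq> A" "\<And>a. a \<in> A \<Longrightarrow> h (f a) = g (h a)" "a \<in> A"
  shows "h ((f ^^ n) a) = (g ^^ n) (h a)"
  using assms by (induction n) (auto simp: funpow_in)

lemma transitive_conj:
  assumes hom: "homeomorphism A B h h'" and inv: "f ` A \<subseteq> A"
    and conj: "\<And>a. a \<in> A \<Longrightarrow> h (f a) = g (h a)" and tr: "transitive B g"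
  shows "transitive A f"
  unfolding transitive_def
proof (intro allI impI)
  fix U V
  assume UV: "openin (top_of_set A) U \<and> U \<noteq> {} \<and> openin (top_of_set A) V \<and> V \<noteq> {}"
  then have sub: "U \<subseteq> A" "V \<subseteq> A"
    by (auto dest: openin_imp_subset)
  have "openin (top_of_set B) (h ` U)" "openin (top_of_set B) (h ` V)"
    using UV homeomorphism_imp_open_map[OF hom] by auto
  with tr UV obtain n where "h ` U \<inter> (g ^^ n) -` (h ` V) \<noteq> {}"
    unfolding transitive_def by (metis image_is_empty)
  then obtain u v where uv: "u \<in> U" "v \<in> V" "(g ^^ n) (h u) = h v"
    by auto
  then have "h ((f ^^ n) u) = h v"
    using funpow_conj[where h = h and f = f and g = g and A = A, OF inv conj] sub by auto
  then have "(f ^^ n) u = v"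
    using hom sub uv funpow_in[OF inv] unfolding homeomorphism_def by (metis subsetD)
  then show "\<exists>n. U \<inter> (f ^^ n) -` V \<noteq> {}"
    using uv by auto
qed

text \<open>Conjugacy of systems: \<open>h\<close> carries \<open>(Y, S)\<close> to \<open>(Z, R)\<close>, with inverse \<open>h'\<close>.\<close>

definition conj_sys where
  "conj_sys Y S Z R h h' \<longleftrightarrow> homeomorphism Y Z h h' \<and> (\<forall>y\<in>Y. h (S y) = R (h y))"

lemma conj_sys_tds:
  assumes "conj_sys Y S Z R h h'" "tds Y S"
  shows "tds Z R"
proof -
  have hom: "homeomorphism Y Z h h'" and c: "\<And>y. y \<in> Y \<Longrightarrow> h (S y) = R (h y)"
    and Y: "Y \<noteq> {}" "compact Y" "continuous_on Y S" "S ` Y = Y"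
    using assms by (auto simp: conj_sys_def tds_def)
  have Z: "Z = h ` Y" and Y': "Y = h' ` Z"
    and hh: "\<And>z. z \<in> Z \<Longrightarrow> h (h' z) = z"
    and ch: "continuous_on Y h" and ch': "continuous_on Z h'"
    using hom by (auto simp: homeomorphism_def)
  have "continuous_on Z (\<lambda>z. h (S (h' z)))"
    by (intro continuous_on_compose2[OF ch] continuous_on_compose2[OF Y(3)] ch')
      (use Y Y' in auto)
  then have "continuous_on Z R"
    by (rule continuous_on_cong[THEN iffD1, rotated -1]) (use c hh Y' in auto)
  moreover have "R ` Z = Z"
  proof -
    have "R ` Z = (\<lambda>y. h (S y)) ` Y"
      unfolding Z using c by (auto simp: image_iff)
    also have "\<dots> = h ` S ` Y" by auto
    finally show ?thesis using Y Z by simp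
  qed
  ultimately show ?thesis
    using Y Z ch compact_continuous_image unfolding tds_def by auto
qed

lemma conj_sys_minimal:
  assumes cs: "conj_sys Y S Z R h h'" and min: "minimal_system Y S"
  shows "minimal_system Z R"
  unfolding minimal_system_def
proof (intro conjI allI impI)
  show "tds Z R"
    using conj_sys_tds[OF cs] min by (simp add: minimal_system_def)
  then have cZ: "compact Z" by (simp add: tds_def)
  have hom: "homeomorphism Y Z h h'" and c: "\<And>y. y \<in> Y \<Longrightarrow> h (S y) = R (h y)"
    and S: "S ` Y = Y"
    using cs min by (auto simp: conj_sys_def minimal_system_def tds_def)
  fix M assume M: "M \<noteq> {} \<and> closed M \<and> M \<subseteq> Z \<and> R ` M \<subseteq> M"
  have hh: "\<And>z. z \<in> Z \<Longrightarrow> h (h' z) = z" "\<And>y. y \<in> Y \<Longrightarrow> h' (h y) = y" and im: "h' ` Z = Y"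
    and ch': "continuous_on Z h'"
    using hom by (auto simp: homeomorphism_def)
  have "compact M"
    using M cZ by (metis compact_Int_closed inf.absorb_iff2)
  then have "closed (h' ` M)"
    using M ch' by (meson compact_continuous_image compact_imp_closed continuous_on_subset)
  moreover have *: "S (h' z) \<in> h' ` M" if "z \<in> M" for z
  proof -
    have z: "z \<in> Z" "h' z \<in> Y" "R z \<in> M"
      using M that im by auto
    have "S (h' z) \<in> Y"
      using z S by blast
    then have "S (h' z) = h' (h (S (h' z)))"
      using hh by simp
    also have "\<dots> = h' (R z)"
      using z c hh by auto
    finally show ?thesis using z by auto
  qed
  moreover have "h' ` M \<noteq> {}" "h' ` M \<subseteq> Y"
    using M im by auto
  moreover have "N = Y" if "N \<noteq> {}" "closed N" "N \<subseteq> Y" "S ` N \<subseteq> N" for N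
    using min that by (simp add: minimal_system_def)
  ultimately have "h' ` M = Y"
    using * by (simp add: image_subset_iff)
  then have "h ` h' ` M = h ` Y" by simp
  moreover have "h ` h' ` M = M"
  proof -
    have "h (h' z) = z" if "z \<in> M" for z
      using hh(1) M that by blast
    then show ?thesis by (simp add: image_image)
  qed
  moreover have "h ` Y = Z"
    using hom by (simp add: homeomorphism_def)
  ultimately show "M = Z" by simp
qed

lemma conj_sys_equicontinuous:
  assumes cs: "conj_sys Y S Z R h h'" and tds: "tds Y S" and eq: "equicontinuous Y S"
  shows "equicontinuous Z R"
  unfolding equicontinuous_def
proof (intro allI impI)
  fix \<epsilon> :: real assume "\<epsilon> > 0"
  have hom: "homeomorphism Y Z h h'" and c: "\<And>y. y \<in> Y \<Longrightarrow> h (S y) = R (h y)"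
    and S: "S ` Y \<subseteq> Y" and cY: "compact Y"
    using cs tds by (auto simp: conj_sys_def tds_def)
  have cZ: "compact Z"
    using conj_sys_tds[OF cs tds] by (simp add: tds_def)
  have hh: "\<And>z. z \<in> Z \<Longrightarrow> h (h' z) = z" and im: "h' ` Z = Y"
    and ch: "continuous_on Y h" and ch': "continuous_on Z h'"
    using hom by (auto simp: homeomorphism_def)
  obtain \<epsilon>1 where 1: "\<epsilon>1 > 0" "\<And>x y. x \<in> Y \<Longrightarrow> y \<in> Y \<Longrightarrow> dist x y < \<epsilon>1 \<Longrightarrow> dist (h x) (h y) < \<epsilon>"
    using compact_uniformly_continuous[OF ch cY] \<open>\<epsilon> > 0\<close>
    unfolding uniformly_continuous_on_def by metis
  obtain \<epsilon>2 where 2: "\<epsilon>2 > 0" "\<And>x y n. x \<in> Y \<Longrightarrow> y \<in> Y \<Longrightarrow> dist x y < \<epsilon>2 \<Longrightarrow>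
      dist ((S ^^ n) x) ((S ^^ n) y) < \<epsilon>1"
    using eq 1(1) unfolding equicontinuous_def by metis
  obtain \<delta> where 3: "\<delta> > 0" "\<And>x y. x \<in> Z \<Longrightarrow> y \<in> Z \<Longrightarrow> dist x y < \<delta> \<Longrightarrow> dist (h' x) (h' y) < \<epsilon>2"
    using compact_uniformly_continuous[OF ch' cZ] 2(1)
    unfolding uniformly_continuous_on_def by metis
  have "dist ((R ^^ n) x) ((R ^^ n) y) < \<epsilon>" if xy: "x \<in> Z" "y \<in> Z" "dist x y < \<delta>" for x y n
  proof -
    have Y: "h' x \<in> Y" "h' y \<in> Y"
      using xy im by auto
    have "dist (h ((S ^^ n) (h' x))) (h ((S ^^ n) (h' y))) < \<epsilon>"
      using 1 2 3 xy Y funpow_in[OF S] by meson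
    then show ?thesis
      using funpow_conj[where h = h and f = S and g = R and A = Y, OF S c] Y hh xy by metis
  qed
  then show "\<exists>\<delta>>0. \<forall>x\<in>Z. \<forall>y\<in>Z. dist x y < \<delta> \<longrightarrow> (\<forall>n. dist ((R ^^ n) x) ((R ^^ n) y) < \<epsilon>)"
    using 3(1) by blast
qed

lemma conj_sys_periodic:
  assumes cs: "conj_sys Y S Z R h h'" and per: "periodic_system Y S"
  shows "periodic_system Z R"
proof -
  have tds: "tds Y S" using per by (simp add: periodic_system_def)
  have hom: "homeomorphism Y Z h h'" and c: "\<And>y. y \<in> Y \<Longrightarrow> h (S y) = R (h y)"
    and S: "S ` Y \<subseteq> Y"
    using cs tds by (auto simp: conj_sys_def tds_def)
  have Z: "Z = h ` Y" using hom by (simp add: homeomorphism_def)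
  obtain y n where y: "y \<in> Y" "n \<ge> 1" "(S ^^ n) y = y" "Y = range (\<lambda>k. (S ^^ k) y)"
    using per unfolding periodic_system_def by blast
  have k: "h ((S ^^ k) y) = (R ^^ k) (h y)" for k
    by (rule funpow_conj[where h = h and f = S and g = R and A = Y, OF S c y(1)])
  have "(R ^^ n) (h y) = h y" using k[of n] y by simp
  moreover have "Z = range (\<lambda>k. (R ^^ k) (h y))"
    unfolding Z by (subst y(4)) (auto simp: k image_iff)
  ultimately show ?thesis
    unfolding periodic_system_def using conj_sys_tds[OF cs tds] y Z by blast
qed

lemma conj_sys_weakly_disjoint:
  assumes cs: "conj_sys Y S Z R h h'" and X: "T ` X = X" and S: "S ` Y = Y"
    and wd: "weakly_disjoint X T Z R"
  shows "weakly_disjoint X T Y S"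
  unfolding weakly_disjoint_def
proof (rule transitive_conj)
  have hom: "homeomorphism Y Z h h'"
    using cs by (simp add: conj_sys_def)
  have h: "continuous_on Y h" "continuous_on Z h'" "h ` Y = Z" "h' ` Z = Y"
    "\<And>y. y \<in> Y \<Longrightarrow> h' (h y) = y" "\<And>z. z \<in> Z \<Longrightarrow> h (h' z) = z"
    using hom by (simp_all add: homeomorphism_def)
  show "homeomorphism (X \<times> Y) (X \<times> Z) (\<lambda>p. (fst p, h (snd p))) (\<lambda>p. (fst p, h' (snd p)))"
  proof (rule homeomorphismI)
    show "continuous_on (X \<times> Y) (\<lambda>p. (fst p, h (snd p)))"
      by (intro continuous_intros continuous_on_compose2[OF h(1)]) auto
    show "continuous_on (X \<times> Z) (\<lambda>p. (fst p, h' (snd p)))"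
      by (intro continuous_intros continuous_on_compose2[OF h(2)]) auto
  qed (use h in auto)
  show "transitive (X \<times> Z) (map_prod T R)"
    using wd by (simp add: weakly_disjoint_def)
  show "map_prod T S ` (X \<times> Y) \<subseteq> X \<times> Y"
    using X S by auto
  show "\<And>a. a \<in> X \<times> Y \<Longrightarrow> (fst (map_prod T S a), h (snd (map_prod T S a))) =
      map_prod T R (fst a, h (snd a))"
    using cs by (auto simp: conj_sys_def)
qed

lemma compact_embeds_in_sequences:
  fixes Y :: "'b::metric_space set"
  assumes "compact Y"
  obtains Z :: "(nat \<Rightarrow> real) set" and h h' where "homeomorphism Y Z h h'"
proof -
  have "\<exists>F. finite F \<and> Y \<subseteq> (\<Union>x\<in>F. ball x (inverse (Suc n)))" for n
    using assms by (simp add: compact_eq_totally_bounded del: of_nat_Suc)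
  then obtain F where F: "\<And>n. finite (F n)" "\<And>n. Y \<subseteq> (\<Union>x\<in>F n. ball x (inverse (Suc n)))"
    by metis
  define D where "D = (\<Union>n. F n)"
  have "countable D"
    unfolding D_def using F(1) by (auto intro: countable_finite)
  define e where "e = from_nat_into D"
  define h where "h = (\<lambda>y n. dist y (e n))"
  have cont: "continuous_on Y h"
    unfolding h_def by (intro continuous_on_coordinatewise_then_product continuous_intros)
  have inj: "x = y" if xy: "x \<in> Y" "y \<in> Y" "h x = h y" for x y
  proof (rule ccontr)
    assume "x \<noteq> y"
    then obtain n where n: "inverse (Suc n) < dist x y / 2"
      by (metis half_gt_zero reals_Archimedean zero_less_dist_iff)
    obtain z where z: "z \<in> F n" "dist z x < inverse (Suc n)"
      using F(2)[of n] xy(1) by auto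
    then have "z \<in> D" by (auto simp: D_def)
    then obtain m where "z = e m"
      unfolding e_def using \<open>countable D\<close> by (metis from_nat_into_surj)
    then have "dist x z = dist y z"
      using xy(3) unfolding h_def by metis
    then show False
      using n z dist_triangle2[of x y z] by (auto simp: dist_commute)
  qed
  then have "inj_on h Y" by (auto simp: inj_on_def)
  then obtain h' where "homeomorphism Y (h ` Y) h h'"
    using homeomorphism_compact[OF assms cont] by blast
  then show ?thesis using that by blast
qed

lemma tds_embeds_in_sequences:
  fixes Y :: "'b::metric_space set"
  assumes "tds Y S"
  obtains Z :: "(nat \<Rightarrow> real) set" and R h h' where "conj_sys Y S Z R h h'"
proof -
  obtain Z :: "(nat \<Rightarrow> real) set" and h h' where hom: "homeomorphism Y Z h h'"
    using assms compact_embeds_in_sequences unfolding tds_def by blast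
  have "conj_sys Y S Z (\<lambda>z. h (S (h' z))) h h'"
    using hom by (auto simp: conj_sys_def homeomorphism_def)
  then show ?thesis using that by blast
qed

lemma scattering_weakly_disjoint:
  fixes Y :: "'b::metric_space set"
  assumes "tds X T" "scattering X T" "minimal_system Y S"
  shows "weakly_disjoint X T Y S"
proof -
  have "tds Y S" using assms by (simp add: minimal_system_def)
  then obtain Z :: "(nat \<Rightarrow> real) set" and R h h' where cs: "conj_sys Y S Z R h h'"
    by (rule tds_embeds_in_sequences)
  have "weakly_disjoint X T Z R"
    using assms conj_sys_minimal[OF cs] by (auto simp: scattering_def)
  then show ?thesis
    using conj_sys_weakly_disjoint[OF cs] \<open>tds X T\<close> \<open>tds Y S\<close> unfolding tds_def by blast
qed

lemma weakly_scattering_weakly_disjoint: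
  fixes Y :: "'b::metric_space set"
  assumes "tds X T" "weakly_scattering X T" "minimal_system Y S" "equicontinuous Y S"
  shows "weakly_disjoint X T Y S"
proof -
  have "tds Y S" using assms by (simp add: minimal_system_def)
  then obtain Z :: "(nat \<Rightarrow> real) set" and R h h' where cs: "conj_sys Y S Z R h h'"
    by (rule tds_embeds_in_sequences)
  have "weakly_disjoint X T Z R"
    using assms conj_sys_minimal[OF cs] conj_sys_equicontinuous[OF cs \<open>tds Y S\<close>]
    by (auto simp: weakly_scattering_def)
  then show ?thesis
    using conj_sys_weakly_disjoint[OF cs] \<open>tds X T\<close> \<open>tds Y S\<close> unfolding tds_def by blast
qed

lemma totally_transitive_weakly_disjoint:
  fixes Y :: "'b::metric_space set"
  assumes "tds X T" "totally_transitive X T" "periodic_system Y S"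
  shows "weakly_disjoint X T Y S"
proof -
  have "tds Y S" using assms by (simp add: periodic_system_def)
  then obtain Z :: "(nat \<Rightarrow> real) set" and R h h' where cs: "conj_sys Y S Z R h h'"
    by (rule tds_embeds_in_sequences)
  have "weakly_disjoint X T Z R"
    using assms conj_sys_periodic[OF cs] by (auto simp: totally_transitive_def)
  then show ?thesis
    using conj_sys_weakly_disjoint[OF cs] \<open>tds X T\<close> \<open>tds Y S\<close> unfolding tds_def by blast
qed

end

theory Submission
  imports Defs
begin

text \<open>
  All five conditions are instances of one criterion: a system \<open>(X, T)\<close> without isolated points
  is densely uniformly chaotic as soon as it has a subsystem \<open>(Y, T)\<close> with \<open>X \<times> Y\<close> transitive
  (\<open>densely_uniformly_chaotic_if_weakly_disjoint_subsystem\<close>).  For \<open>Y\<close> one takes a fixed point, a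
  periodic orbit, a minimal subset, an equicontinuous minimal subset, or \<open>X\<close> itself.

  The criterion rests on the lemma \<open>refinement\<close>: any finitely many nonempty open sets contain
  points that are simultaneously almost proximal and almost recurrent.  Proximality of points
  from different open sets \<open>V i\<close> looks like a statement about the transitivity of powers of
  \<open>X\<close>, but it is enough to look at points \<open>T\<^sup>k x\<close> of one orbit, with a different \<open>k\<close> for each
  \<open>i\<close>.  Transitivity of \<open>X \<times> Y\<close> allows one to choose these \<open>k\<close> such that in addition some
  \<open>y \<in> Y\<close> is near one and the same point at all the times \<open>k\<close>.  When \<open>x\<close> later comes near \<open>y\<close>, its
  companions \<open>T\<^sup>k x\<close> come near each other.  Recurrence is simpler: if \<open>x\<close> returns close to
  itself, so do its images \<open>T\<^sup>k x\<close>, with the same return time.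

  Iterating the refinement gives a Cantor scheme with ever more roots, one in each set of a
  countable \<open>\<pi>\<close>-base of \<open>X\<close>.  Since all sets of one level share one return time and one time of
  proximality, the Cantor sets cut out by finitely many roots are uniformly rigid and uniformly
  proximal, and their union is dense, rigid along the sequence of the return times, and proximal.

  For a transitive system with a periodic point \<open>p\<close> of order \<open>d\<close>, the closure \<open>X0\<close> of the
  \<open>T\<^sup>d\<close>-orbit of a point with dense \<open>T\<close>-orbit is a transitive perfect system for \<open>T\<^sup>d\<close> whose
  images under the first \<open>d\<close> powers of \<open>T\<close> cover \<open>X\<close> (\<open>power_decomposition\<close>).  It contains a
  point of the orbit of \<open>p\<close>, which is fixed by \<open>T\<^sup>d\<close>, so the fixed point case applies to it.
\<close>

section \<open>Open sets of visiting points\<close>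

lemma tds_funpow_in:
  assumes "tds X T" "x \<in> X"
  shows "(T ^^ n) x \<in> X"
  using assms by (intro funpow_in) (auto simp: tds_def)

lemma tds_continuous_funpow:
  assumes "tds X T"
  shows "continuous_on X (T ^^ n)"
proof (induction n)
  case (Suc n)
  have "continuous_on X T" "(T ^^ n) ` X \<subseteq> X"
    using assms tds_funpow_in[OF assms] by (auto simp: tds_def)
  then have "continuous_on X (\<lambda>x. T ((T ^^ n) x))"
    by (intro continuous_on_compose2[OF _ Suc])
  then show ?case by (simp add: comp_def)
qed simp

lemma openin_visiting:
  assumes "tds X T" "openin (top_of_set X) V"
  shows "openin (top_of_set X) {x \<in> X. (T ^^ n) x \<in> V}"
proof -
  have "openin (top_of_set X) (X \<inter> (T ^^ n) -` V)"
    using assms tds_funpow_in[OF assms(1)]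
    by (intro continuous_openin_preimage[OF tds_continuous_funpow]) auto
  then show ?thesis by (simp add: vimage_def Int_def)
qed

lemma openin_dist_less:
  fixes f g :: "'a::metric_space \<Rightarrow> 'b::metric_space"
  assumes "continuous_on X f" "continuous_on X g"
  shows "openin (top_of_set X) {x \<in> X. dist (f x) (g x) < \<epsilon>}"
proof -
  have "openin (top_of_set X) (X \<inter> (\<lambda>x. dist (f x) (g x)) -` {..<\<epsilon>})"
    using assms by (intro continuous_openin_preimage_gen continuous_intros) auto
  then show ?thesis by (simp add: vimage_def Int_def)
qed

lemma openin_finite_All:
  assumes "finite I" "\<And>i. i \<in> I \<Longrightarrow> openin (top_of_set X) {x \<in> X. P i x}"
  shows "openin (top_of_set X) {x \<in> X. \<forall>i\<in>I. P i x}"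
  using assms
proof (induction I)
  case (insert j I)
  have "{x \<in> X. \<forall>i\<in>insert j I. P i x} = {x \<in> X. P j x} \<inter> {x \<in> X. \<forall>i\<in>I. P i x}"
    by auto
  with insert show ?case by (simp add: openin_Int)
qed simp

lemma transitiveD:
  assumes "transitive X T" "openin (top_of_set X) U" "U \<noteq> {}"
    "openin (top_of_set X) V" "V \<noteq> {}"
  obtains n u where "u \<in> U" "(T ^^ n) u \<in> V"
proof -
  obtain n where "U \<inter> (T ^^ n) -` V \<noteq> {}"
    using assms unfolding transitive_def by meson
  then show ?thesis using that by auto
qed

lemma weakly_disjointD:
  assumes wd: "weakly_disjoint X T Y S"
    and U: "openin (top_of_set X) U" "U \<noteq> {}" "openin (top_of_set X) U'" "U' \<noteq> {}"
    and V: "openin (top_of_set Y) V" "V \<noteq> {}" "openin (top_of_set Y) V'" "V' \<noteq> {}"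
  obtains n u v where "u \<in> U" "(T ^^ n) u \<in> U'" "v \<in> V" "(S ^^ n) v \<in> V'"
proof -
  have "openin (top_of_set (X \<times> Y)) (U \<times> V)" "openin (top_of_set (X \<times> Y)) (U' \<times> V')"
    using U V by (auto intro: openin_Times)
  moreover have "U \<times> V \<noteq> {}" "U' \<times> V' \<noteq> {}"
    using U V by auto
  ultimately obtain n p where p: "p \<in> U \<times> V" "(map_prod T S ^^ n) p \<in> U' \<times> V'"
    using transitiveD[OF wd[unfolded weakly_disjoint_def]] by metis
  have iter: "(map_prod T S ^^ n) (u, v) = ((T ^^ n) u, (S ^^ n) v)" for u v
    by (induction n) auto
  obtain u v where "p = (u, v)" by (cases p)
  with p that[of u n v] show ?thesis by (simp add: iter)
qed

lemma weakly_disjoint_imp_transitive: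
  assumes "weakly_disjoint X T Y S" "Y \<noteq> {}"
  shows "transitive X T"
  unfolding transitive_def
proof (intro allI impI)
  fix U V
  assume UV: "openin (top_of_set X) U \<and> U \<noteq> {} \<and> openin (top_of_set X) V \<and> V \<noteq> {}"
  show "\<exists>n. U \<inter> (T ^^ n) -` V \<noteq> {}"
    using weakly_disjointD[OF assms(1), of U V Y Y] UV assms(2)
    by (metis IntI empty_iff openin_subtopology_self vimage_eq)
qed

section \<open>Simultaneous visits, returns and proximality\<close>

text \<open>
  The times are found one after the other.  Once the points \<open>x\<close> (respectively \<open>y\<close>) that make
  the visits for the indices treated so far fill a nonempty open set, transitivity of the
  product yields a further common time at which this set meets the next \<open>V j\<close> (respectively
  \<open>W j\<close>).
\<close>

lemma simultaneous_visits:
  assumes X: "tds X T" and Y: "tds Y S" and wd: "weakly_disjoint X T Y S" and "finite I"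
    and V: "\<And>i. i \<in> I \<Longrightarrow> openin (top_of_set X) (V i) \<and> V i \<noteq> {}"
    and W: "\<And>i. i \<in> I \<Longrightarrow> openin (top_of_set Y) (W i) \<and> W i \<noteq> {}"
  obtains k x y where "x \<in> X" "y \<in> Y"
    "\<And>i. i \<in> I \<Longrightarrow> (T ^^ k i) x \<in> V i" "\<And>i. i \<in> I \<Longrightarrow> (S ^^ k i) y \<in> W i"
proof -
  have "\<exists>k. {x \<in> X. \<forall>i\<in>I. (T ^^ k i) x \<in> V i} \<noteq> {} \<and> {y \<in> Y. \<forall>i\<in>I. (S ^^ k i) y \<in> W i} \<noteq> {}"
    using \<open>finite I\<close> V W
  proof (induction I)
    case empty
    then show ?case using X Y by (auto simp: tds_def)
  next
    case (insert j I)
    define G where "G k = {x \<in> X. \<forall>i\<in>I. (T ^^ k i) x \<in> V i}" for k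
    define H where "H k = {y \<in> Y. \<forall>i\<in>I. (S ^^ k i) y \<in> W i}" for k
    have "\<exists>k. G k \<noteq> {} \<and> H k \<noteq> {}"
      unfolding G_def H_def using insert.prems by (intro insert.IH) blast+
    then obtain k where k: "G k \<noteq> {}" "H k \<noteq> {}" by blast
    have "openin (top_of_set X) (G k)" "openin (top_of_set Y) (H k)"
      unfolding G_def H_def using insert.hyps insert.prems
      by (intro openin_finite_All openin_visiting[OF X] openin_visiting[OF Y]; blast)+
    with k insert.prems[of j] obtain n u v where
      uv: "u \<in> G k" "(T ^^ n) u \<in> V j" "v \<in> H k" "(S ^^ n) v \<in> W j"
      using weakly_disjointD[OF wd, of "G k" "V j" "H k" "W j"] by (metis insertI1)
    have "u \<in> {x \<in> X. \<forall>i\<in>insert j I. (T ^^ (k(j := n)) i) x \<in> V i}"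
      "v \<in> {y \<in> Y. \<forall>i\<in>insert j I. (S ^^ (k(j := n)) i) y \<in> W i}"
      using uv insert.hyps by (auto simp: G_def H_def)
    then show ?case by blast
  qed
  with that show thesis by blast
qed

lemma infinite_openin_perfect:
  assumes "no_isolated_points X" "openin (top_of_set X) U" "U \<noteq> {}"
  shows "infinite (U :: 'a::metric_space set)"
proof
  assume fin: "finite U"
  obtain O' where O': "open O'" "U = X \<inter> O'"
    using assms(2) by (auto simp: openin_open)
  obtain u where u: "u \<in> U" using assms(3) by blast
  then have "u islimpt X" "\<forall>\<^sub>F y in at u. y \<in> O'"
    using assms(1) O' by (auto simp: no_isolated_points_def eventually_at_topological)
  then have "u islimpt X \<inter> O'"
    by (rule islimpt_Int_eventually)
  then show False
    using fin O' islimpt_finite by blast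
qed

text \<open>
  A nonempty open set \<open>G\<close> contains two disjoint nonempty open sets, and a passage from one to
  the other takes at least one step.  Larger return times come from returns of the open set
  of points that have already returned once.
\<close>

lemma return_time_ge:
  fixes X :: "'a::metric_space set"
  assumes X: "tds X T" "no_isolated_points X" "transitive X T"
    and G: "openin (top_of_set X) G" "G \<noteq> {}"
  obtains m z where "m \<ge> N" "z \<in> G" "(T ^^ m) z \<in> G"
proof -
  have one: "\<exists>m\<ge>1. \<exists>z\<in>U. (T ^^ m) z \<in> U" if U: "openin (top_of_set X) U" "U \<noteq> {}" for U
  proof -
    have "infinite U"
      using infinite_openin_perfect X(2) U by blast
    then obtain a b where ab: "a \<in> U" "b \<in> U" "a \<noteq> b"
      by (metis finite.emptyI finite_insert finite_subset insertI1 subsetI)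
    then obtain A B where AB: "open A" "open B" "a \<in> A" "b \<in> B" "A \<inter> B = {}"
      using hausdorff[OF ab(3)] by blast
    have "U \<inter> A \<noteq> {}" "U \<inter> B \<noteq> {}"
      using AB ab by blast+
    with AB(1,2) obtain n u where u: "u \<in> U \<inter> A" "(T ^^ n) u \<in> U \<inter> B"
      using transitiveD[OF X(3) openin_Int_open[OF U(1)] _ openin_Int_open[OF U(1)]] by metis
    with AB have "n \<noteq> 0" by (cases n) auto
    with u show ?thesis by (intro exI[of _ n]) auto
  qed
  have "\<exists>m\<ge>N. \<exists>z\<in>G. (T ^^ m) z \<in> G"
  proof (induction N)
    case 0
    show ?case using one[OF G] by auto
  next
    case (Suc N)
    then obtain m where m: "m \<ge> N" "\<exists>z\<in>G. (T ^^ m) z \<in> G" by blast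
    define G' where "G' = G \<inter> {x \<in> X. (T ^^ m) x \<in> G}"
    have "openin (top_of_set X) G'"
      unfolding G'_def using G openin_visiting[OF X(1)] by (intro openin_Int) auto
    moreover have "G' \<noteq> {}"
      using m G openin_imp_subset unfolding G'_def by blast
    ultimately obtain l z where lz: "l \<ge> 1" "z \<in> G'" "(T ^^ l) z \<in> G'"
      using one by blast
    then have "(T ^^ (m + l)) z \<in> G"
      by (simp add: G'_def funpow_add)
    with lz m show ?case
      by (intro exI[of _ "m + l"]) (auto simp: G'_def)
  qed
  with that show thesis by blast
qed

lemma distinct_representatives:
  assumes "finite I" "\<And>i. i \<in> I \<Longrightarrow> infinite (V i)"
  obtains x where "inj_on x I" "\<And>i. i \<in> I \<Longrightarrow> x i \<in> V i"
proof -
  have "\<exists>x. inj_on x I \<and> (\<forall>i\<in>I. x i \<in> V i)"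
    using assms
  proof (induction I)
    case (insert j I)
    then obtain x where x: "inj_on x I" "\<forall>i\<in>I. x i \<in> V i" by auto
    obtain a where a: "a \<in> V j" "a \<notin> x ` I"
      using insert by (metis finite_imageI finite_subset insertI1 subsetI)
    show ?case
      using x a insert.hyps by (intro exI[of _ "x(j := a)"]) (auto simp: inj_on_def)
  qed simp
  with that show thesis by blast
qed

lemma finite_points_separated:
  fixes A :: "'a::metric_space set"
  assumes "finite A"
  obtains \<delta> where "\<delta> > 0" "\<And>p q. p \<in> A \<Longrightarrow> q \<in> A \<Longrightarrow> p \<noteq> q \<Longrightarrow> \<delta> \<le> dist p q"
proof -
  obtain d where d: "\<And>p. d p > 0" "\<And>p q. q \<in> A \<Longrightarrow> q \<noteq> p \<Longrightarrow> d p \<le> dist p q"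
    using finite_set_avoid[OF assms] by metis
  show thesis
  proof (cases "A = {}")
    case False
    show ?thesis
    proof
      show "Min (d ` A) > 0"
        using False assms d(1) by simp
    next
      fix p q assume "p \<in> A" "q \<in> A" "p \<noteq> q"
      then show "Min (d ` A) \<le> dist p q"
        using d(2)[of q p] assms by (intro order_trans[OF Min_le]) auto
    qed
  qed (use that[of 1] in auto)
qed

text \<open>
  In a perfect space each \<open>V i\<close> is infinite, so the sets \<open>V i\<close> have distinct representatives,
  and small balls around these are disjoint.
\<close>

lemma disjoint_open_shrinking:
  fixes V :: "'i \<Rightarrow> 'a::metric_space set"
  assumes "no_isolated_points X" "finite I"
    and V: "\<And>i. i \<in> I \<Longrightarrow> openin (top_of_set X) (V i) \<and> V i \<noteq> {}"
  obtains V' where "\<And>i. i \<in> I \<Longrightarrow> openin (top_of_set X) (V' i) \<and> V' i \<noteq> {} \<and> V' i \<subseteq> V i"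
    "\<And>i j. i \<in> I \<Longrightarrow> j \<in> I \<Longrightarrow> i \<noteq> j \<Longrightarrow> V' i \<inter> V' j = {}"
proof -
  obtain x where x: "inj_on x I" "\<And>i. i \<in> I \<Longrightarrow> x i \<in> V i"
    using distinct_representatives[of I V] infinite_openin_perfect assms by metis
  obtain \<delta> where \<delta>: "\<delta> > 0" "\<And>p q. p \<in> x ` I \<Longrightarrow> q \<in> x ` I \<Longrightarrow> p \<noteq> q \<Longrightarrow> \<delta> \<le> dist p q"
    using finite_points_separated[of "x ` I"] \<open>finite I\<close> by auto
  define V' where "V' i = V i \<inter> ball (x i) (\<delta> / 2)" for i
  show thesis
  proof
    fix i assume "i \<in> I"
    then have "openin (top_of_set X) (V' i)" "x i \<in> V' i"
      using V x(2) \<delta>(1) by (auto simp: V'_def intro: openin_Int_open)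
    then show "openin (top_of_set X) (V' i) \<and> V' i \<noteq> {} \<and> V' i \<subseteq> V i"
      by (auto simp: V'_def)
  next
    fix i j assume ij: "i \<in> I" "j \<in> I" "i \<noteq> j"
    then have "\<delta> \<le> dist (x i) (x j)"
      using \<delta>(2) x(1) by (auto simp: inj_on_def)
    then show "V' i \<inter> V' j = {}"
      using dist_triangle_half_r[of _ "x i" \<delta> "x j"]
      by (force simp: V'_def dist_commute not_less)
  qed
qed

lemma finite_common_radius:
  fixes c :: "'i \<Rightarrow> 'a::metric_space"
  assumes "finite I" "\<And>i. i \<in> I \<Longrightarrow> openin (top_of_set X) (Q i) \<and> c i \<in> Q i" "\<epsilon> > 0"
  obtains r where "0 < r" "r < \<epsilon>" "\<And>i. i \<in> I \<Longrightarrow> X \<inter> cball (c i) r \<subseteq> Q i"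
proof -
  have "\<exists>r>0. r < \<epsilon> \<and> (\<forall>i\<in>I. X \<inter> cball (c i) r \<subseteq> Q i)"
    using assms(1,2)
  proof (induction I)
    case empty
    then show ?case using \<open>\<epsilon> > 0\<close> dense by auto
  next
    case (insert j I)
    then obtain r where r: "r > 0" "r < \<epsilon>" "\<forall>i\<in>I. X \<inter> cball (c i) r \<subseteq> Q i" by auto
    obtain r' where r': "r' > 0" "cball (c j) r' \<inter> X \<subseteq> Q j"
      using insert.prems by (metis insertI1 openin_contains_cball)
    show ?case
      using r r' by (intro exI[of _ "min r r'"]) fastforce
  qed
  with that show thesis by blast
qed

text \<open>
  One stage of the construction, with precision \<open>\<epsilon>\<close>.  Each \<open>E i\<close> contains a nonempty open set so
  that the next stage can be built inside it.  The return time \<open>m\<close> is a parameter because the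
  return times of the successive stages must form one increasing sequence; about the times of
  proximality only the existence matters.
\<close>

definition rigid_proximal_family ::
  "'a::metric_space set \<Rightarrow> ('a \<Rightarrow> 'a) \<Rightarrow> real \<Rightarrow> 'i set \<Rightarrow> ('i \<Rightarrow> 'a set) \<Rightarrow> nat \<Rightarrow> bool" where
  "rigid_proximal_family X T \<epsilon> I E m \<longleftrightarrow>
     (\<forall>i\<in>I. E i \<subseteq> X \<and> compact (E i) \<and>
        (\<exists>U. openin (top_of_set X) U \<and> U \<noteq> {} \<and> U \<subseteq> E i)) \<and>
     (\<forall>i\<in>I. \<forall>j\<in>I. i \<noteq> j \<longrightarrow> E i \<inter> E j = {}) \<and>
     (\<forall>i\<in>I. \<forall>x\<in>E i. \<forall>y\<in>E i. dist x y < \<epsilon>) \<and>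
     (\<forall>i\<in>I. \<forall>x\<in>E i. dist ((T ^^ m) x) x < \<epsilon>) \<and>
     (\<exists>n. \<forall>i\<in>I. \<forall>j\<in>I. \<forall>x\<in>E i. \<forall>y\<in>E j. dist ((T ^^ n) x) ((T ^^ n) y) < \<epsilon>)"

text \<open>
  All points that matter lie on one orbit.  There are times \<open>k i\<close> such that a nonempty open set
  \<open>G\<close> is carried into every \<open>V i\<close>, by \<open>T\<close> to the power \<open>k i\<close>, while a point \<open>y\<close> of \<open>Y\<close> is
  carried at all these times into one small ball around a point \<open>w\<close> of \<open>Y\<close>.  Since \<open>y\<close> also
  lies in \<open>X\<close>, the orbit of some \<open>u\<close> in \<open>G\<close> comes so close to \<open>y\<close>, say at time \<open>m'\<close>, that it
  shares these later visits to the ball.  The images of \<open>u\<close> at the times \<open>k i\<close>, which lie in the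
  sets \<open>V i\<close>, are then all near \<open>w\<close> after \<open>m'\<close> further steps: this is the proximality.  A late
  return of a point \<open>z\<close> near \<open>u\<close> makes the images of \<open>z\<close> at the times \<open>k i\<close> return together:
  this is the rigidity.  Both properties are open conditions, so they extend to small balls
  around these images.
\<close>

lemma refinement:
  fixes X :: "'a::metric_space set" and V :: "'i \<Rightarrow> 'a set"
  assumes X: "tds X T" "no_isolated_points X" and Y: "tds Y T" "Y \<subseteq> X"
    and wd: "weakly_disjoint X T Y T" and "finite I" "\<epsilon> > 0"
    and V: "\<And>i. i \<in> I \<Longrightarrow> openin (top_of_set X) (V i) \<and> V i \<noteq> {}"
  obtains E m where "m \<ge> N" "rigid_proximal_family X T \<epsilon> I E m" "\<And>i. i \<in> I \<Longrightarrow> E i \<subseteq> V i"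
proof -
  have tr: "transitive X T"
    using weakly_disjoint_imp_transitive[OF wd] Y by (simp add: tds_def)
  obtain V' where V': "\<And>i. i \<in> I \<Longrightarrow> openin (top_of_set X) (V' i) \<and> V' i \<noteq> {} \<and> V' i \<subseteq> V i"
    and disj: "\<And>i j. i \<in> I \<Longrightarrow> j \<in> I \<Longrightarrow> i \<noteq> j \<Longrightarrow> V' i \<inter> V' j = {}"
    using disjoint_open_shrinking[OF X(2) \<open>finite I\<close>, of V] V by metis
  obtain w where w: "w \<in> Y" using Y by (auto simp: tds_def)
  define W where "W = X \<inter> ball w (\<epsilon> / 2)"
  have W: "openin (top_of_set X) W"
    unfolding W_def by blast
  have WY: "openin (top_of_set Y) (Y \<inter> ball w (\<epsilon> / 2))" "Y \<inter> ball w (\<epsilon> / 2) \<noteq> {}"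
    using w \<open>\<epsilon> > 0\<close> by auto
  obtain k x y where xy: "x \<in> X" "y \<in> Y" "\<And>i. i \<in> I \<Longrightarrow> (T ^^ k i) x \<in> V' i"
      "\<And>i. i \<in> I \<Longrightarrow> (T ^^ k i) y \<in> Y \<inter> ball w (\<epsilon> / 2)"
    using simultaneous_visits[OF X(1) Y(1) wd \<open>finite I\<close>, of V' "\<lambda>_. Y \<inter> ball w (\<epsilon> / 2)"] V' WY
    by metis
  define G where "G = {x \<in> X. \<forall>i\<in>I. (T ^^ k i) x \<in> V' i}"
  define H where "H = {x \<in> X. \<forall>i\<in>I. (T ^^ k i) x \<in> W}"
  have oGH: "openin (top_of_set X) G" "openin (top_of_set X) H"
    unfolding G_def H_def using \<open>finite I\<close> V' W
    by (auto intro!: openin_finite_All openin_visiting[OF X(1)])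
  have ne: "x \<in> G" "y \<in> H"
    using xy Y by (auto simp: G_def H_def W_def)
  obtain m' u where u: "u \<in> G" "(T ^^ m') u \<in> H"
    using transitiveD[OF tr oGH(1) _ oGH(2)] ne by blast
  \<comment> \<open>Two points of \<open>G'\<close> are \<open>\<epsilon>\<close>-close at every time \<open>k i\<close>, so a return to \<open>G'\<close> is a
    simultaneous return at all of these times.\<close>
  define G' where "G' = G \<inter> {x \<in> X. (T ^^ m') x \<in> H} \<inter>
      {x \<in> X. \<forall>i\<in>I. dist ((T ^^ k i) x) ((T ^^ k i) u) < \<epsilon> / 2}"
  have "openin (top_of_set X) G'"
    unfolding G'_def using \<open>finite I\<close>
    by (intro openin_Int oGH openin_visiting[OF X(1)] openin_finite_All openin_dist_less
        tds_continuous_funpow[OF X(1)] continuous_on_const)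
  moreover have "u \<in> G'"
    using u \<open>\<epsilon> > 0\<close> by (auto simp: G'_def G_def)
  ultimately obtain m z where m: "m \<ge> N" and z: "z \<in> G'" "(T ^^ m) z \<in> G'"
    using return_time_ge[OF X tr, of G' N] by blast
  have zX: "z \<in> X" using z by (auto simp: G'_def)
  define c where "c i = (T ^^ k i) z" for i
  \<comment> \<open>The open conditions, all satisfied at \<open>c i\<close>, that the ball around \<open>c i\<close> has to inherit.\<close>
  define Q where "Q i = V' i \<inter> {x \<in> X. (T ^^ m') x \<in> W} \<inter> {x \<in> X. dist ((T ^^ m) x) x < \<epsilon>}" for i
  have comm: "(T ^^ a) ((T ^^ b) x) = (T ^^ b) ((T ^^ a) x)" for a b x
    by (metis add.commute funpow_add o_apply)
  have cX: "c i \<in> X" for i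
    unfolding c_def by (rule tds_funpow_in[OF X(1) zX])
  have Q: "openin (top_of_set X) (Q i) \<and> c i \<in> Q i" if i: "i \<in> I" for i
  proof
    show "openin (top_of_set X) (Q i)"
      unfolding Q_def using V'[OF i]
      by (intro openin_Int openin_visiting[OF X(1)] W openin_dist_less
          tds_continuous_funpow[OF X(1)] continuous_on_id) auto
    have "dist ((T ^^ k i) ((T ^^ m) z)) ((T ^^ k i) z) < \<epsilon>"
      by (rule dist_triangle_half_l[of _ "(T ^^ k i) u"]) (use z i in \<open>simp_all add: G'_def\<close>)
    moreover have "c i \<in> V' i"
      using z i by (auto simp: G'_def G_def c_def)
    moreover have "(T ^^ m') (c i) \<in> W"
      using z i by (auto simp: G'_def H_def c_def comm[of m'])
    ultimately show "c i \<in> Q i"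
      using cX by (simp add: Q_def c_def comm[of m])
  qed
  obtain r where r: "0 < r" "r < \<epsilon> / 2" "\<And>i. i \<in> I \<Longrightarrow> X \<inter> cball (c i) r \<subseteq> Q i"
    using finite_common_radius[of I X Q c "\<epsilon> / 2"] Q \<open>finite I\<close> \<open>\<epsilon> > 0\<close> by (metis half_gt_zero)
  define E where "E i = X \<inter> cball (c i) r" for i
  have inQ: "x \<in> Q i" if "i \<in> I" "x \<in> E i" for i x
    using r(3) that unfolding E_def by blast
  have "E i \<subseteq> X \<and> compact (E i) \<and> (\<exists>U. openin (top_of_set X) U \<and> U \<noteq> {} \<and> U \<subseteq> E i)" for i
  proof (intro conjI exI)
    show "E i \<subseteq> X" by (simp add: E_def)
    show "compact (E i)"
      using X(1) by (auto simp: E_def tds_def intro: compact_Int_closed)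
    show "openin (top_of_set X) (X \<inter> ball (c i) r)" by blast
    show "X \<inter> ball (c i) r \<noteq> {}" using cX[of i] r(1) by (auto intro!: exI[of _ "c i"])
    show "X \<inter> ball (c i) r \<subseteq> E i" by (auto simp: E_def)
  qed
  moreover have "E i \<inter> E j = {}" if ij: "i \<in> I" "j \<in> I" "i \<noteq> j" for i j
  proof -
    have "x \<in> V' i \<inter> V' j" if "x \<in> E i \<inter> E j" for x
      using inQ[OF ij(1), of x] inQ[OF ij(2), of x] that by (simp add: Q_def)
    with disj[OF ij] show ?thesis by blast
  qed
  moreover have "dist x y < \<epsilon>" if "x \<in> E i" "y \<in> E i" for i x y
    by (rule dist_triangle_half_r[of "c i"]) (use that r(2) in \<open>auto simp: E_def\<close>)
  moreover have "dist ((T ^^ m) x) x < \<epsilon>" if "i \<in> I" "x \<in> E i" for i x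
    using inQ[OF that] by (simp add: Q_def)
  moreover have "dist ((T ^^ m') x) ((T ^^ m') y) < \<epsilon>"
    if "i \<in> I" "j \<in> I" "x \<in> E i" "y \<in> E j" for i j x y
  proof (rule dist_triangle_half_r)
    show "dist w ((T ^^ m') x) < \<epsilon> / 2" "dist w ((T ^^ m') y) < \<epsilon> / 2"
      using inQ that by (simp_all add: Q_def W_def)
  qed
  ultimately have "rigid_proximal_family X T \<epsilon> I E m"
    unfolding rigid_proximal_family_def by blast
  moreover have "E i \<subseteq> V i" if "i \<in> I" for i
    using inQ[OF that] V'[OF that] unfolding Q_def by blast
  ultimately show thesis
    using that m by blast
qed

section \<open>Subspaces of the Cantor space\<close>

lemma open_cylinder: "open {\<tau> :: nat \<Rightarrow> bool. \<forall>i<k. \<tau> i = \<sigma> i}"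
proof -
  have "{\<tau> :: nat \<Rightarrow> bool. \<forall>i<k. \<tau> i = \<sigma> i} = Pi\<^sub>E UNIV (\<lambda>i. if i < k then {\<sigma> i} else UNIV)"
    by (auto simp: PiE_iff split: if_splits)
  moreover have "finite {i. (if i < k then {\<sigma> i} else UNIV) \<noteq> UNIV}"
    by (rule finite_subset[of _ "{..<k}"]) auto
  ultimately show ?thesis
    by (simp add: open_PiE open_discrete)
qed

lemma continuous_on_cylinderI:
  fixes f :: "(nat \<Rightarrow> bool) \<Rightarrow> 'b::topological_space"
  assumes "\<And>\<sigma> U. \<sigma> \<in> D \<Longrightarrow> open U \<Longrightarrow> f \<sigma> \<in> U \<Longrightarrow>
    \<exists>k. \<forall>\<tau>\<in>D. (\<forall>i<k. \<tau> i = \<sigma> i) \<longrightarrow> f \<tau> \<in> U"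
  shows "continuous_on D f"
  unfolding continuous_on_topological
proof (intro ballI allI impI)
  fix \<sigma> U assume "\<sigma> \<in> D" "open U" "f \<sigma> \<in> U"
  then obtain k where "\<forall>\<tau>\<in>D. (\<forall>i<k. \<tau> i = \<sigma> i) \<longrightarrow> f \<tau> \<in> U"
    using assms by blast
  then show "\<exists>A. open A \<and> \<sigma> \<in> A \<and> (\<forall>y\<in>D. y \<in> A \<longrightarrow> f y \<in> U)"
    using open_cylinder[of k \<sigma>] by (intro exI[of _ "{\<tau>. \<forall>i<k. \<tau> i = \<sigma> i}"]) auto
qed

text \<open>
  The bound \<open>N + i + 1\<close> leaves room for maps that inspect the first \<open>N\<close> places and, depending on
  what they find there, shift the other places by one.
\<close>

lemma continuous_on_cantor_map:
  fixes f :: "(nat \<Rightarrow> bool) \<Rightarrow> nat \<Rightarrow> bool"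
  assumes "\<And>\<sigma> \<tau> i. \<forall>j \<le> N + i + 1. \<tau> j = \<sigma> j \<Longrightarrow> f \<tau> i = f \<sigma> i"
  shows "continuous_on D f"
proof (rule continuous_on_coordinatewise_then_product, rule continuous_on_cylinderI)
  fix i \<sigma> and U :: "bool set" assume "\<sigma> \<in> D" "open U" "f \<sigma> i \<in> U"
  then have "f \<tau> i \<in> U" if "\<forall>j < N + i + 2. \<tau> j = \<sigma> j" for \<tau>
    using assms[of i \<tau> \<sigma>] that by simp
  then show "\<exists>k. \<forall>\<tau>\<in>D. (\<forall>j<k. \<tau> j = \<sigma> j) \<longrightarrow> f \<tau> i \<in> U" by blast
qed

lemma compact_cantor_space: "compact (UNIV :: (nat \<Rightarrow> bool) set)"
proof -
  have "compact_space (euclidean :: bool topology)"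
    by (simp add: compact_space_def finite_imp_compact)
  then have "compact_space (product_topology (\<lambda>_::nat. euclidean :: bool topology) UNIV)"
    by (simp add: compact_space_product_topology)
  then show ?thesis
    by (simp add: euclidean_product_topology compact_space_def)
qed

text \<open>
  The part of the Cantor space that misses the cylinder of words starting with \<open>N + 1\<close> zeros is
  again a Cantor space: stretch its last subcylinder \<open>0\<^sup>N 1\<close> to the cylinder \<open>0\<^sup>N\<close>, that is,
  delete the first \<open>1\<close> if it stands at place \<open>N\<close>.
\<close>

lemma cantor_set_early_True:
  "cantor_set {\<sigma> :: nat \<Rightarrow> bool. \<exists>i\<le>N. \<sigma> i}" (is "cantor_set ?D")
proof -
  define h :: "(nat \<Rightarrow> bool) \<Rightarrow> nat \<Rightarrow> bool"
    where "h \<sigma> i = (if (\<exists>j<N. \<sigma> j) \<or> i < N then \<sigma> i else \<sigma> (Suc i))" for \<sigma> i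
  define g :: "(nat \<Rightarrow> bool) \<Rightarrow> nat \<Rightarrow> bool"
    where "g \<tau> i = (if \<exists>j<N. \<tau> j then \<tau> i else i = N \<or> i > N \<and> \<tau> (i - 1))" for \<tau> i
  have ex_h: "(\<exists>j<N. h \<sigma> j) \<longleftrightarrow> (\<exists>j<N. \<sigma> j)" for \<sigma>
    by (auto simp: h_def)
  have ex_g: "(\<exists>j<N. g \<tau> j) \<longleftrightarrow> (\<exists>j<N. \<tau> j)" for \<tau>
    by (auto simp: g_def)
  have "homeomorphism ?D UNIV h g"
  proof (rule homeomorphismI)
    show "continuous_on ?D h"
    proof (rule continuous_on_cantor_map)
      fix \<sigma> \<tau> :: "nat \<Rightarrow> bool" and i assume "\<forall>j\<le>N + i + 1. \<tau> j = \<sigma> j"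
      then have "(\<exists>j<N. \<tau> j) = (\<exists>j<N. \<sigma> j)" "\<tau> i = \<sigma> i" "\<tau> (Suc i) = \<sigma> (Suc i)"
        by auto
      then show "h \<tau> i = h \<sigma> i" by (simp only: h_def)
    qed
    show "continuous_on UNIV g"
    proof (rule continuous_on_cantor_map)
      fix \<sigma> \<tau> :: "nat \<Rightarrow> bool" and i assume "\<forall>j\<le>N + i + 1. \<tau> j = \<sigma> j"
      then have "(\<exists>j<N. \<tau> j) = (\<exists>j<N. \<sigma> j)" "\<tau> i = \<sigma> i" "\<tau> (i - 1) = \<sigma> (i - 1)"
        by auto
      then show "g \<tau> i = g \<sigma> i" by (simp only: g_def)
    qed
    show "g ` UNIV \<subseteq> ?D"
      by (auto simp: g_def) (metis le_refl less_imp_le)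
    show "g (h \<sigma>) = \<sigma>" if "\<sigma> \<in> ?D" for \<sigma>
    proof
      fix i
      show "g (h \<sigma>) i = \<sigma> i"
      proof (cases "\<exists>j<N. \<sigma> j")
        case True
        then show ?thesis
          unfolding g_def[of "h \<sigma>"] ex_h by (simp add: h_def)
      next
        case False
        then have N: "\<sigma> N"
          using \<open>\<sigma> \<in> ?D\<close> by (auto simp: le_less)
        consider "i < N" | "i = N" | "i > N" by linarith
        then show ?thesis
          unfolding g_def[of "h \<sigma>"] ex_h using False N by cases (auto simp: h_def)
      qed
    qed
    show "h (g \<tau>) = \<tau>" if "\<tau> \<in> UNIV" for \<tau>
    proof
      fix i
      show "h (g \<tau>) i = \<tau> i"
      proof (cases "\<exists>j<N. \<tau> j")
        case True
        then show ?thesis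
          unfolding h_def[of "g \<tau>"] ex_g by (simp add: g_def)
      next
        case False
        then show ?thesis
          unfolding h_def[of "g \<tau>"] ex_g by (auto simp: g_def)
      qed
    qed
  qed simp
  then show ?thesis
    unfolding cantor_set_def homeomorphic_def by blast
qed

section \<open>A tree of compact sets\<close>

text \<open>
  Nodes of the tree are words over \<open>{0, 1}\<close>.  A word \<open>0\<^sup>k\<close> carries no set; its successor
  \<open>0\<^sup>k 1\<close> is the root of a new binary subtree.  In this way one tree indexed by the Cantor
  space minus its zero sequence holds countably many Cantor sets, and the sequences with a \<open>1\<close> at
  one of the first \<open>N + 1\<close> places form the union of the first \<open>N + 1\<close> of them.
\<close>

definition nodes :: "nat \<Rightarrow> bool list set" where
  "nodes k = {s. length s = k \<and> True \<in> set s}"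

definition branch :: "(nat \<Rightarrow> bool) \<Rightarrow> nat \<Rightarrow> bool list" where
  "branch \<sigma> k = map \<sigma> [0..<k]"

lemma finite_nodes: "finite (nodes k)"
proof (rule finite_subset)
  show "nodes k \<subseteq> {s. set s \<subseteq> UNIV \<and> length s = k}"
    by (auto simp: nodes_def)
qed (rule finite_lists_length_eq, simp)

lemma branch_Suc: "branch \<sigma> (Suc k) = branch \<sigma> k @ [\<sigma> k]"
  by (simp add: branch_def)

lemma branch_in_nodes: "branch \<sigma> k \<in> nodes k \<longleftrightarrow> (\<exists>i<k. \<sigma> i)"
  by (force simp: branch_def nodes_def image_iff)

lemma branch_eq_iff: "branch \<sigma> k = branch \<tau> k \<longleftrightarrow> (\<forall>i<k. \<sigma> i = \<tau> i)"
  by (auto simp: branch_def)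

lemma countable_pi_base:
  fixes X :: "'a::metric_space set"
  assumes "compact X" "X \<noteq> {}"
  obtains B :: "nat \<Rightarrow> 'a set"
  where "\<And>k. openin (top_of_set X) (B k)" "\<And>k. B k \<noteq> {}"
    "\<And>U. openin (top_of_set X) U \<Longrightarrow> U \<noteq> {} \<Longrightarrow> \<exists>k. B k \<subseteq> U"
proof -
  have "\<exists>F. finite F \<and> F \<subseteq> X \<and> X \<subseteq> (\<Union>x\<in>F. ball x (inverse (Suc n)))" for n
    using assms(1) compactE_image[of X X "\<lambda>x. ball x (inverse (Suc n))"]
    by (metis UN_I centre_in_ball inverse_positive_iff_positive of_nat_0_less_iff open_ball subsetI
        zero_less_Suc)
  then obtain F where F: "\<And>n. finite (F n)" "\<And>n. F n \<subseteq> X"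
      "\<And>n. X \<subseteq> (\<Union>x\<in>F n. ball x (inverse (Suc n)))"
    by metis
  define \<B> where "\<B> = (\<Union>n. (\<lambda>x. X \<inter> ball x (inverse (Suc n))) ` F n)"
  have cB: "countable \<B>"
    unfolding \<B>_def using F(1) by (intro countable_UN countable_image) (auto intro: countable_finite)
  have oB: "openin (top_of_set X) U \<and> U \<noteq> {}" if U: "U \<in> \<B>" for U
  proof -
    obtain n x where "x \<in> F n" "U = X \<inter> ball x (inverse (Suc n))"
      using U unfolding \<B>_def by blast
    moreover then have "x \<in> U" using F(2) by (auto simp del: of_nat_Suc)
    ultimately show ?thesis by blast
  qed
  have sB: "\<exists>V\<in>\<B>. V \<subseteq> U" if U: "openin (top_of_set X) U" "U \<noteq> {}" for U
  proof -
    obtain u where u: "u \<in> U" using U by blast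
    then obtain e where e: "e > 0" "ball u e \<inter> X \<subseteq> U" "u \<in> X"
      using U by (metis openin_contains_ball openin_imp_subset subsetD)
    obtain n where n: "inverse (real (Suc n)) < e / 2"
      using e(1) reals_Archimedean half_gt_zero by blast
    obtain x where x: "x \<in> F n" "u \<in> ball x (inverse (Suc n))"
      using F(3)[of n] e(3) by blast
    have "X \<inter> ball x (inverse (Suc n)) \<subseteq> U"
    proof
      fix y assume y: "y \<in> X \<inter> ball x (inverse (Suc n))"
      have "dist u y < e"
        by (rule dist_triangle_half_r[of x]) (use x y n in \<open>auto simp del: of_nat_Suc\<close>)
      with e y show "y \<in> U" by auto
    qed
    with x show ?thesis unfolding \<B>_def by blast
  qed
  have ne: "\<B> \<noteq> {}"
    using sB[of X] assms(2) by auto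
  show thesis
  proof (rule that[of "from_nat_into \<B>"])
    show "openin (top_of_set X) (from_nat_into \<B> k)" "from_nat_into \<B> k \<noteq> {}" for k
      using oB from_nat_into[OF ne] by blast+
    show "\<exists>k. from_nat_into \<B> k \<subseteq> U" if "openin (top_of_set X) U" "U \<noteq> {}" for U
      using sB[OF that] from_nat_into_surj[OF cB] by metis
  qed
qed

text \<open>
  A node of length \<open>k + 1\<close> either extends a node of length \<open>k\<close>, and gets a set inside the set of
  its parent, or is \<open>0\<^sup>k 1\<close>, and gets a set inside \<open>B k\<close>.  Refining all these open sets
  simultaneously keeps the return times and the proximality common to all subtrees.
\<close>

lemma tree_exists:
  fixes X :: "'a::metric_space set"
  assumes X: "tds X T" "no_isolated_points X" and Y: "tds Y T" "Y \<subseteq> X"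
    and wd: "weakly_disjoint X T Y T"
    and B: "\<And>k. openin (top_of_set X) (B k)" "\<And>k. B k \<noteq> {}"
  obtains E :: "nat \<Rightarrow> bool list \<Rightarrow> 'a set" and m where "strict_mono m"
    "\<And>k. rigid_proximal_family X T (1 / Suc k) (nodes k) (E k) (m k)"
    "\<And>k s b. s \<in> nodes k \<Longrightarrow> E (Suc k) (s @ [b]) \<subseteq> E k s"
    "\<And>k. E (Suc k) (replicate k False @ [True]) \<subseteq> B k"
proof -
  define P where "P k = (\<lambda>(E, m). rigid_proximal_family X T (1 / Suc k) (nodes k) E m)" for k
  define R where
    "R k = (\<lambda>(E :: bool list \<Rightarrow> 'a set, m :: nat) (E' :: bool list \<Rightarrow> 'a set, m' :: nat). m < m' \<and> (\<forall>s\<in>nodes k. \<forall>b. E' (s @ [b]) \<subseteq> E s) \<and>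
    E' (replicate k False @ [True]) \<subseteq> B k)" for k :: nat
  have "\<exists>f. \<forall>k. P k (f k) \<and> R k (f k) (f (Suc k))"
  proof (rule dependent_nat_choice)
    have "nodes 0 = {}" by (auto simp: nodes_def)
    then have "P 0 (\<lambda>_. {}, 0)" by (simp add: P_def rigid_proximal_family_def)
    then show "\<exists>x. P 0 x" ..
  next
    fix x k assume Px: "P k x"
    obtain E m where x: "x = (E, m)" by (cases x)
    have fam: "rigid_proximal_family X T (1 / Suc k) (nodes k) E m"
      using Px by (simp add: P_def x)
    then have "\<exists>U. openin (top_of_set X) U \<and> U \<noteq> {} \<and> U \<subseteq> E s" if "s \<in> nodes k" for s
      using that by (simp add: rigid_proximal_family_def)
    then obtain U where U: "\<And>s. s \<in> nodes k \<Longrightarrow> openin (top_of_set X) (U s) \<and> U s \<noteq> {} \<and> U s \<subseteq> E s"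
      by metis
    define V where "V t = (if butlast t \<in> nodes k then U (butlast t) else B k)" for t
    have V: "openin (top_of_set X) (V t) \<and> V t \<noteq> {}" for t
      using U B by (simp add: V_def)
    obtain E' m' where E': "m' \<ge> Suc m"
        "rigid_proximal_family X T (1 / Suc (Suc k)) (nodes (Suc k)) E' m'"
        "\<And>t. t \<in> nodes (Suc k) \<Longrightarrow> E' t \<subseteq> V t"
      using refinement[OF X Y wd finite_nodes[of "Suc k"], of "1 / Suc (Suc k)" V "Suc m"] V
      by (metis of_nat_0_less_iff zero_less_Suc zero_less_divide_1_iff)
    have "E' (s @ [b]) \<subseteq> E s" if s: "s \<in> nodes k" for s b
    proof -
      have "s @ [b] \<in> nodes (Suc k)" using s by (auto simp: nodes_def)
      from E'(3)[OF this] show ?thesis using U[OF s] s by (auto simp: V_def)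
    qed
    moreover have "E' (replicate k False @ [True]) \<subseteq> B k"
    proof -
      have "replicate k False @ [True] \<in> nodes (Suc k)" by (auto simp: nodes_def)
      moreover have "replicate k False \<notin> nodes k" by (auto simp: nodes_def)
      ultimately show ?thesis using E'(3)[of "replicate k False @ [True]"] by (simp add: V_def)
    qed
    ultimately have "P (Suc k) (E', m') \<and> R k x (E', m')"
      using E' by (simp add: P_def R_def x)
    then show "\<exists>y. P (Suc k) y \<and> R k x y" ..
  qed
  then obtain f where f: "\<And>k. P k (f k)" "\<And>k. R k (f k) (f (Suc k))" by blast
  show thesis
  proof (rule that[of "snd \<circ> f" "fst \<circ> f"])
    show "strict_mono (snd \<circ> f)"
    proof -
      have "snd (f k) < snd (f (Suc k))" for k
        using f(2)[of k] by (auto simp: R_def split: prod.splits)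
      then show ?thesis by (simp add: strict_mono_Suc_iff)
    qed
  next
    show "rigid_proximal_family X T (1 / Suc k) (nodes k) ((fst \<circ> f) k) ((snd \<circ> f) k)" for k
      using f(1)[of k] by (auto simp: P_def split: prod.splits)
  next
    show "(fst \<circ> f) (Suc k) (s @ [b]) \<subseteq> (fst \<circ> f) k s" if "s \<in> nodes k" for k s b
      using f(2)[of k] that by (auto simp: R_def split: prod.splits)
  next
    show "(fst \<circ> f) (Suc k) (replicate k False @ [True]) \<subseteq> B k" for k
      using f(2)[of k] by (auto simp: R_def split: prod.splits)
  qed
qed

section \<open>The dense uniformly chaotic set\<close>

lemma compact_chain_Inter:
  assumes "compact X" "\<C> \<noteq> {}"
    and C: "\<And>C. C \<in> \<C> \<Longrightarrow> closed C \<and> C \<noteq> {} \<and> C \<subseteq> X"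
    and chain: "\<And>C D. C \<in> \<C> \<Longrightarrow> D \<in> \<C> \<Longrightarrow> C \<subseteq> D \<or> D \<subseteq> C"
  shows "\<Inter>\<C> \<noteq> {}"
proof -
  have "X \<inter> \<Inter>\<C> \<noteq> {}"
  proof (rule compact_imp_fip[OF \<open>compact X\<close>])
    fix \<F> assume \<F>: "finite \<F>" "\<F> \<subseteq> \<C>"
    show "X \<inter> \<Inter>\<F> \<noteq> {}"
    proof (cases "\<F> = {}")
      case True
      then show ?thesis using assms(2) C by fastforce
    next
      case False
      have "C \<inter> D \<in> \<F>" if CD: "C \<in> \<F>" "D \<in> \<F>" for C D
      proof -
        consider "C \<subseteq> D" | "D \<subseteq> C" using chain CD \<F>(2) by blast
        then show ?thesis using CD by cases (simp_all add: Int_absorb1 Int_absorb2)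
      qed
      then have "\<Inter>\<F> \<in> \<F>"
        by (rule finite_Inf_in[OF \<F>(1) False])
      then show ?thesis using \<F> C by blast
    qed
  qed (use C in blast)
  then show ?thesis by blast
qed

lemma diameter_le_dist:
  fixes S :: "'a::metric_space set"
  assumes "0 \<le> d" "\<And>x y. x \<in> S \<Longrightarrow> y \<in> S \<Longrightarrow> dist x y \<le> d"
  shows "diameter S \<le> d"
proof (cases "S = {}")
  case False
  then have "(SUP (x, y)\<in>S \<times> S. dist x y) \<le> d"
    using assms(2) by (intro cSUP_least) auto
  with False show ?thesis by (simp add: diameter_def)
qed (simp add: diameter_def assms(1))

lemma uniformly_proximalI:
  assumes "\<And>\<epsilon>. \<epsilon> > 0 \<Longrightarrow> \<exists>n. \<forall>x\<in>K. \<forall>y\<in>K. dist ((T ^^ n) x) ((T ^^ n) y) < \<epsilon>"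
  shows "uniformly_proximal T K"
  unfolding uniformly_proximal_def
proof (intro allI impI)
  fix \<epsilon> :: real assume \<epsilon>: "\<epsilon> > 0"
  then obtain n where "\<forall>x\<in>K. \<forall>y\<in>K. dist ((T ^^ n) x) ((T ^^ n) y) < \<epsilon> / 2"
    using assms half_gt_zero by blast
  then have "diameter ((T ^^ n) ` K) \<le> \<epsilon> / 2"
    using \<epsilon> by (intro diameter_le_dist) (auto intro: less_imp_le)
  then show "\<exists>n. diameter ((T ^^ n) ` K) < \<epsilon>"
    using \<epsilon> by (intro exI[of _ n]) simp
qed

text \<open>
  Each binary sequence with a \<open>1\<close> singles out a branch of the tree and thereby a point \<open>\<phi> \<sigma>\<close>.
  The sequences with a \<open>1\<close> at one of the first \<open>N + 1\<close> places form a Cantor space, on which \<open>\<phi>\<close>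
  is injective (sets of one level are disjoint) and continuous (they shrink).  From level
  \<open>N + 1\<close> on, each image of such a sequence lies in some set of the level, so the times attached
  to these levels work uniformly on the whole \<open>N\<close>-th Cantor set.  Density holds because \<open>\<phi>\<close> takes a
  value in each set of a countable \<open>\<pi>\<close>-base.
\<close>

theorem densely_uniformly_chaotic_if_weakly_disjoint_subsystem:
  fixes X :: "'a::metric_space set"
  assumes X: "tds X T" "no_isolated_points X" and Y: "tds Y T" "Y \<subseteq> X"
    and wd: "weakly_disjoint X T Y T"
  shows "densely_uniformly_chaotic X T"
proof -
  have cX: "compact X" "X \<noteq> {}" using X by (auto simp: tds_def)
  obtain B :: "nat \<Rightarrow> 'a set"
    where B: "\<And>k. openin (top_of_set X) (B k)" "\<And>k. B k \<noteq> {}"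
      "\<And>U. openin (top_of_set X) U \<Longrightarrow> U \<noteq> {} \<Longrightarrow> \<exists>k. B k \<subseteq> U"
    using countable_pi_base[OF cX] by metis
  obtain E m where m: "strict_mono m"
    and fam: "\<And>k. rigid_proximal_family X T (1 / Suc k) (nodes k) (E k) (m k)"
    and desc: "\<And>k s b. s \<in> nodes k \<Longrightarrow> E (Suc k) (s @ [b]) \<subseteq> E k s"
    and root: "\<And>k. E (Suc k) (replicate k False @ [True]) \<subseteq> B k"
    using tree_exists[OF X Y wd, of B] B by metis
  have E: "E k s \<subseteq> X" "compact (E k s)" "E k s \<noteq> {}" if "s \<in> nodes k" for k s
    using fam[of k] that unfolding rigid_proximal_family_def by auto
  have E_disj: "E k s \<inter> E k t = {}" if "s \<in> nodes k" "t \<in> nodes k" "s \<noteq> t" for k s t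
    using fam[of k] that unfolding rigid_proximal_family_def by simp
  have E_diam: "dist x y < 1 / Suc k" if "s \<in> nodes k" "x \<in> E k s" "y \<in> E k s" for k s x y
    using fam[of k] that unfolding rigid_proximal_family_def by simp
  have E_rigid: "dist ((T ^^ m k) x) x < 1 / Suc k" if "s \<in> nodes k" "x \<in> E k s" for k s x
    using fam[of k] that unfolding rigid_proximal_family_def by simp
  have E_prox: "\<exists>n. \<forall>s\<in>nodes k. \<forall>t\<in>nodes k. \<forall>x\<in>E k s. \<forall>y\<in>E k t.
      dist ((T ^^ n) x) ((T ^^ n) y) < 1 / Suc k" for k
    using fam[of k] unfolding rigid_proximal_family_def by blast
  have "\<exists>x. \<forall>k. (\<exists>i<k. \<sigma> i) \<longrightarrow> x \<in> E k (branch \<sigma> k)" for \<sigma>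
  proof (cases "\<exists>i. \<sigma> i")
    case True
    then obtain i where i: "\<sigma> i" by blast
    define \<C> where "\<C> = (\<lambda>k. E k (branch \<sigma> k)) ` {k. \<exists>i<k. \<sigma> i}"
    have mono: "E l (branch \<sigma> l) \<subseteq> E k (branch \<sigma> k)" if "k \<le> l" "\<exists>i<k. \<sigma> i" for k l
      using that
    proof (induction l rule: dec_induct)
      case (step l)
      then have "branch \<sigma> l \<in> nodes l"
        unfolding branch_in_nodes by (meson order_less_le_trans)
      from desc[OF this] have "E (Suc l) (branch \<sigma> (Suc l)) \<subseteq> E l (branch \<sigma> l)"
        by (simp add: branch_Suc)
      with step show ?case by blast
    qed simp
    have "\<Inter>\<C> \<noteq> {}"
    proof (rule compact_chain_Inter[OF cX(1)])
      show "\<C> \<noteq> {}" using i by (auto simp: \<C>_def)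
      show "closed C \<and> C \<noteq> {} \<and> C \<subseteq> X" if "C \<in> \<C>" for C
      proof -
        have "\<exists>k. C = E k (branch \<sigma> k) \<and> branch \<sigma> k \<in> nodes k"
          using that by (auto simp: \<C>_def branch_in_nodes)
        then show ?thesis using E compact_imp_closed by metis
      qed
      show "C \<subseteq> D \<or> D \<subseteq> C" if CD: "C \<in> \<C>" "D \<in> \<C>" for C D
      proof -
        obtain k l where kl: "C = E k (branch \<sigma> k)" "\<exists>i<k. \<sigma> i"
            "D = E l (branch \<sigma> l)" "\<exists>i<l. \<sigma> i"
          using CD unfolding \<C>_def by blast
        show ?thesis
          unfolding kl(1,3) using mono[of k l] mono[of l k] kl(2,4) by (meson nat_le_linear)
      qed
    qed
    then show ?thesis unfolding \<C>_def by blast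
  qed simp
  then obtain \<phi> where \<phi>: "\<And>\<sigma> k. \<exists>i<k. \<sigma> i \<Longrightarrow> \<phi> \<sigma> \<in> E k (branch \<sigma> k)"
    by metis
  define D where "D N = {\<sigma> :: nat \<Rightarrow> bool. \<exists>i\<le>N. \<sigma> i}" for N
  define C where "C N = \<phi> ` D N" for N
  have D: "\<exists>i<k. \<sigma> i" if "\<sigma> \<in> D N" "N < k" for \<sigma> k N
    using that by (auto simp: D_def intro: le_less_trans)
  have cover: "\<exists>s\<in>nodes k. x \<in> E k s" if "x \<in> C N" "N < k" for x N k
    using that D \<phi> branch_in_nodes unfolding C_def by blast
  have small: "\<exists>k>N. 1 / real (Suc k) < \<epsilon>" if pos: "\<epsilon> > 0" for \<epsilon> :: real and N
  proof -
    obtain k0 where k0: "1 / real (Suc k0) < \<epsilon>"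
      using nat_approx_posE[OF pos] by blast
    have "1 / real (Suc (max k0 (Suc N))) \<le> 1 / real (Suc k0)"
      by (intro divide_left_mono) auto
    with k0 show ?thesis by (intro exI[of _ "max k0 (Suc N)"]) auto
  qed
  have cantor: "cantor_set (C N)" for N
  proof -
    have DN: "D N homeomorphic (UNIV :: (nat \<Rightarrow> bool) set)"
      using cantor_set_early_True by (simp add: cantor_set_def D_def)
    have "continuous_on (D N) \<phi>"
    proof (rule continuous_on_cylinderI)
      fix \<sigma> U assume \<sigma>: "\<sigma> \<in> D N" "open U" "\<phi> \<sigma> \<in> U"
      then obtain \<epsilon> where \<epsilon>: "\<epsilon> > 0" "ball (\<phi> \<sigma>) \<epsilon> \<subseteq> U"
        by (auto simp: open_contains_ball)
      obtain k where k: "k > N" "1 / real (Suc k) < \<epsilon>"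
        using small[OF \<epsilon>(1)] by blast
      have "\<phi> \<tau> \<in> U" if "\<tau> \<in> D N" "\<forall>i<k. \<tau> i = \<sigma> i" for \<tau>
      proof -
        have "branch \<tau> k = branch \<sigma> k" using that by (simp add: branch_eq_iff)
        moreover have "\<phi> \<tau> \<in> E k (branch \<tau> k)" "\<phi> \<sigma> \<in> E k (branch \<sigma> k)"
          using \<phi> D k(1) \<sigma>(1) that(1) by blast+
        ultimately have "dist (\<phi> \<sigma>) (\<phi> \<tau>) < 1 / Suc k"
          using E_diam[of "branch \<sigma> k" k] D[OF \<sigma>(1) k(1)] by (simp add: branch_in_nodes)
        with k \<epsilon> show ?thesis by (auto simp del: of_nat_Suc)
      qed
      then show "\<exists>k. \<forall>\<tau>\<in>D N. (\<forall>i<k. \<tau> i = \<sigma> i) \<longrightarrow> \<phi> \<tau> \<in> U" by blast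
    qed
    moreover have "inj_on \<phi> (D N)"
    proof (rule inj_onI, rule ccontr)
      fix \<sigma> \<tau> assume *: "\<sigma> \<in> D N" "\<tau> \<in> D N" "\<phi> \<sigma> = \<phi> \<tau>" "\<sigma> \<noteq> \<tau>"
      then obtain i where i: "\<sigma> i \<noteq> \<tau> i" by blast
      define k where "k = Suc (max N i)"
      have k: "N < k" "i < k" by (auto simp: k_def)
      then have "branch \<sigma> k \<noteq> branch \<tau> k" using i by (auto simp: branch_eq_iff)
      then show False
        using E_disj[of "branch \<sigma> k" k "branch \<tau> k"] \<phi>[of k \<sigma>] \<phi>[of k \<tau>] * D k
        by (metis IntI branch_in_nodes empty_iff)
    qed
    moreover have "compact (D N)"
      using homeomorphic_compactness[OF DN] compact_cantor_space by blast
    ultimately have "D N homeomorphic C N"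
      unfolding C_def using homeomorphic_compact by blast
    then show ?thesis
      unfolding cantor_set_def using DN homeomorphic_sym homeomorphic_trans by blast
  qed
  have C_mono: "C M \<subseteq> C N" if "M \<le> N" for M N
    using that unfolding C_def D_def by (auto intro!: image_mono intro: order_trans)
  have C_rigid: "dist ((T ^^ m k) x) x < 1 / Suc k" if "x \<in> C N" "k > N" for x N k
    using cover[OF that] E_rigid by blast
  have C_prox: "\<exists>n. \<forall>x\<in>C N. \<forall>y\<in>C N. dist ((T ^^ n) x) ((T ^^ n) y) < \<epsilon>" if pos: "\<epsilon> > 0" for N \<epsilon>
  proof -
    obtain k where k: "k > N" "1 / real (Suc k) < \<epsilon>"
      using small[OF pos] by blast
    obtain n where n: "\<And>s t x y. s \<in> nodes k \<Longrightarrow> t \<in> nodes k \<Longrightarrow> x \<in> E k s \<Longrightarrow> y \<in> E k t \<Longrightarrow>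
        dist ((T ^^ n) x) ((T ^^ n) y) < 1 / Suc k"
      using E_prox[of k] by blast
    have "dist ((T ^^ n) x) ((T ^^ n) y) < \<epsilon>" if "x \<in> C N" "y \<in> C N" for x y
      using cover[OF that(1) k(1)] cover[OF that(2) k(1)] n k(2) by (meson less_trans)
    then show ?thesis by blast
  qed
  define K where "K = (\<Union>N. C N)"
  have "rigid T K"
    unfolding rigid_def
  proof (intro exI[of _ m] conjI ballI m metric_LIMSEQ_I)
    fix x and \<epsilon> :: real assume "x \<in> K" "\<epsilon> > 0"
    then obtain N where N: "x \<in> C N" by (auto simp: K_def)
    obtain k where k: "k > N" "1 / real (Suc k) < \<epsilon>"
      using small[OF \<open>\<epsilon> > 0\<close>] by blast
    have "dist ((T ^^ m l) x) x < \<epsilon>" if "l \<ge> k" for l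
    proof -
      have "dist ((T ^^ m l) x) x < 1 / Suc l"
        using C_rigid[OF N] k that by simp
      also have "\<dots> \<le> 1 / Suc k"
        using that by (intro divide_left_mono) auto
      finally show ?thesis using k by simp
    qed
    then show "\<exists>no. \<forall>n\<ge>no. dist ((T ^^ m n) x) x < \<epsilon>" by blast
  qed
  moreover have "proximal T K"
    unfolding proximal_def
  proof (intro allI impI)
    fix F assume F: "finite F \<and> F \<subseteq> K"
    have "\<exists>N. F \<subseteq> C N"
      using F[THEN conjunct1] F[THEN conjunct2]
    proof (induction F)
      case (insert x F)
      then obtain N M where "F \<subseteq> C N" "x \<in> C M" by (auto simp: K_def)
      then have "insert x F \<subseteq> C (max N M)"
        using C_mono[of N "max N M"] C_mono[of M "max N M"] by auto
      then show ?case ..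
    qed simp
    then obtain N where "F \<subseteq> C N" ..
    then show "uniformly_proximal T F"
      using C_prox[of _ N] by (intro uniformly_proximalI) (meson subsetD)
  qed
  moreover have "uniformly_rigid T (C N)" for N
    unfolding uniformly_rigid_def
  proof (intro allI impI)
    fix \<epsilon> :: real assume "\<epsilon> > 0"
    then obtain k where k: "k > N" "1 / real (Suc k) < \<epsilon>"
      using small by blast
    have "m k \<ge> 1" using strict_mono_imp_increasing[OF m, of k] k(1) by linarith
    moreover have "\<forall>x\<in>C N. dist ((T ^^ m k) x) x < \<epsilon>"
      using C_rigid[OF _ k(1)] k(2) less_trans by blast
    ultimately show "\<exists>n\<ge>1. \<forall>x\<in>C N. dist ((T ^^ n) x) x < \<epsilon>" by blast
  qed
  moreover have "uniformly_proximal T (C N)" for N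
    by (rule uniformly_proximalI) (rule C_prox)
  moreover have "K \<subseteq> X"
    using cover E(1) unfolding K_def by blast
  ultimately have "uniformly_chaotic_set X T K"
    unfolding uniformly_chaotic_set_def using cantor C_mono K_def
    by (intro conjI exI[of _ C]) auto
  moreover have "X \<subseteq> closure K"
  proof
    fix x assume x: "x \<in> X"
    have "\<exists>y\<in>K. dist y x < \<epsilon>" if "\<epsilon> > 0" for \<epsilon>
    proof -
      have "openin (top_of_set X) (X \<inter> ball x \<epsilon>)" "X \<inter> ball x \<epsilon> \<noteq> {}"
        using x that by (auto intro!: exI[of _ x])
      then obtain k where k: "B k \<subseteq> X \<inter> ball x \<epsilon>" using B(3) by blast
      define \<sigma> where "\<sigma> i = (i = k)" for i
      have "branch \<sigma> (Suc k) = replicate k False @ [True]"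
        by (intro nth_equalityI) (auto simp: branch_def \<sigma>_def nth_append)
      then have "\<phi> \<sigma> \<in> B k"
        using \<phi>[of "Suc k" \<sigma>] root[of k] by (auto simp: \<sigma>_def)
      with k have "dist (\<phi> \<sigma>) x < \<epsilon>"
        by (auto simp: dist_commute)
      moreover have "\<sigma> \<in> D k"
        by (simp add: D_def \<sigma>_def)
      then have "\<phi> \<sigma> \<in> K"
        unfolding K_def C_def by blast
      ultimately show ?thesis by blast
    qed
    then show "x \<in> closure K" by (simp add: closure_approachable)
  qed
  ultimately show ?thesis
    unfolding densely_uniformly_chaotic_def by blast
qed

section \<open>Minimal subsystems\<close>

text \<open>
  Zorn's lemma is applied to the complements of the nonempty closed invariant subsets; compactness
  keeps the intersection of a chain of such subsets nonempty.  The image of a minimal such set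
  is again one, hence the map is onto on it.
\<close>

lemma minimal_subset_exists:
  assumes X: "tds X T"
  obtains M where "minimal_subset X T M"
proof -
  define \<U> where "\<U> = {U. closed (- U) \<and> - U \<noteq> {} \<and> - U \<subseteq> X \<and> T ` (- U) \<subseteq> - U}"
  have "\<exists>U\<in>\<U>. \<forall>V\<in>\<U>. U \<subseteq> V \<longrightarrow> V = U"
  proof (rule subset_Zorn_nonempty)
    have "- X \<in> \<U>"
      using X compact_imp_closed by (auto simp: \<U>_def tds_def)
    then show "\<U> \<noteq> {}" by blast
  next
    fix \<C> assume \<C>: "\<C> \<noteq> {}" "subset.chain \<U> \<C>"
    have sub: "\<C> \<subseteq> \<U>" and lin: "\<And>U V. U \<in> \<C> \<Longrightarrow> V \<in> \<C> \<Longrightarrow> U \<subseteq> V \<or> V \<subseteq> U"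
      using \<C>(2) by (auto simp: subset_chain_def)
    have compl: "- \<Union>\<C> = \<Inter>(uminus ` \<C>)" by auto
    have "\<Inter>(uminus ` \<C>) \<noteq> {}"
    proof (rule compact_chain_Inter)
      show "compact X" using X by (simp add: tds_def)
      show "uminus ` \<C> \<noteq> {}" using \<C>(1) by simp
      show "closed C \<and> C \<noteq> {} \<and> C \<subseteq> X" if "C \<in> uminus ` \<C>" for C
        using that sub by (auto simp: \<U>_def)
      show "C \<subseteq> D \<or> D \<subseteq> C" if "C \<in> uminus ` \<C>" "D \<in> uminus ` \<C>" for C D
        using that lin by auto
    qed
    moreover have "closed (\<Inter>(uminus ` \<C>))"
      using sub by (intro closed_Inter) (auto simp: \<U>_def)
    moreover have "\<Inter>(uminus ` \<C>) \<subseteq> X"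
      using \<C>(1) sub by (auto simp: \<U>_def)
    moreover have "T ` \<Inter>(uminus ` \<C>) \<subseteq> \<Inter>(uminus ` \<C>)"
      using sub by (fastforce simp: \<U>_def)
    ultimately show "\<Union>\<C> \<in> \<U>"
      unfolding \<U>_def compl[symmetric] by simp
  qed
  then obtain U where U: "U \<in> \<U>" and max: "\<And>V. V \<in> \<U> \<Longrightarrow> U \<subseteq> V \<Longrightarrow> V = U"
    by blast
  define M where "M = - U"
  have M: "closed M" "M \<noteq> {}" "M \<subseteq> X" "T ` M \<subseteq> M"
    using U by (auto simp: M_def \<U>_def)
  have min: "N = M" if N: "N \<noteq> {}" "closed N" "N \<subseteq> M" "T ` N \<subseteq> N" for N
  proof -
    have "- N \<in> \<U>" using N M(3) by (auto simp: \<U>_def)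
    moreover have "U \<subseteq> - N" using N(3) by (auto simp: M_def)
    ultimately show ?thesis using max by (auto simp: M_def)
  qed
  have cM: "compact M"
    using X M(1,3) by (metis compact_Int_closed inf.absorb_iff2 tds_def)
  have cont: "continuous_on M T"
    using X M(3) continuous_on_subset unfolding tds_def by blast
  have "T ` M = M"
  proof (rule min)
    show "closed (T ` M)"
      using cM cont compact_continuous_image compact_imp_closed by blast
  qed (use M in auto)
  then have "minimal_system M T"
    unfolding minimal_system_def tds_def using M cM cont min by blast
  then show thesis
    using that M(3) unfolding minimal_subset_def by blast
qed

lemma periodic_orbit_system:
  fixes X :: "'a::metric_space set"
  assumes X: "tds X T" and p: "p \<in> X" "n \<ge> 1" "(T ^^ n) p = p"
  defines "Y \<equiv> range (\<lambda>k. (T ^^ k) p)"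
  shows "periodic_system Y T" "Y \<subseteq> X"
proof -
  have orbit: "(T ^^ k) p \<in> Y" for k
    unfolding Y_def by (rule rangeI)
  show sub: "Y \<subseteq> X"
    using tds_funpow_in[OF X p(1)] by (auto simp: Y_def)
  have "(T ^^ k) p = (T ^^ (k mod n)) p" for k
    using p(3) by (simp add: funpow_mod_eq)
  then have "Y \<subseteq> (\<lambda>k. (T ^^ k) p) ` {..<n}"
    using p(2) unfolding Y_def by (intro image_subsetI) (metis imageI lessThan_iff mod_less_divisor not_gr0 not_one_le_zero)
  then have "compact Y"
    by (intro finite_imp_compact) (meson finite_imageI finite_lessThan finite_subset)
  moreover have "continuous_on Y T"
    using X sub continuous_on_subset unfolding tds_def by blast
  moreover have "T ` Y = Y"
  proof
    have "T ((T ^^ k) p) \<in> Y" for k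
      using orbit[of "Suc k"] by simp
    then show "T ` Y \<subseteq> Y" by (auto simp: Y_def)
    have "(T ^^ k) p \<in> T ` Y" for k
    proof -
      have "(T ^^ k) p = (T ^^ (k + n)) p"
        using p(3) by (simp add: funpow_add)
      also have "k + n = Suc (k + (n - 1))" using p(2) by simp
      also have "(T ^^ Suc (k + (n - 1))) p = T ((T ^^ (k + (n - 1))) p)" by simp
      finally show ?thesis using orbit by blast
    qed
    then show "Y \<subseteq> T ` Y" unfolding Y_def by blast
  qed
  moreover have pY: "p \<in> Y"
    using orbit[of 0] by simp
  ultimately have "tds Y T"
    by (auto simp: tds_def)
  then show "periodic_system Y T"
    unfolding periodic_system_def using p pY Y_def by blast
qed

lemma densely_uniformly_chaotic_if_fixed_point:
  fixes X :: "'a::metric_space set"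
  assumes X: "tds X T" "no_isolated_points X" and tr: "transitive X T"
    and p: "p \<in> X" "T p = p"
  shows "densely_uniformly_chaotic X T"
proof (rule densely_uniformly_chaotic_if_weakly_disjoint_subsystem[OF X])
  show "tds {p} T" "{p} \<subseteq> X" using p by (auto simp: tds_def)
  show "weakly_disjoint X T {p} T"
    unfolding weakly_disjoint_def
  proof (rule transitive_conj[OF _ _ _ tr])
    show "homeomorphism (X \<times> {p}) X fst (\<lambda>x. (x, p))"
      by (rule homeomorphismI) (auto intro!: continuous_intros)
    show "map_prod T T ` (X \<times> {p}) \<subseteq> X \<times> {p}"
      using X(1) p by (auto simp: tds_def)
    show "fst (map_prod T T a) = T (fst a)" if "a \<in> X \<times> {p}" for a
      by (cases a) simp
  qed
qed

section \<open>Decomposition under a power of the map\<close>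

text \<open>
  The points whose orbits visit a given set of a countable \<open>\<pi>\<close>-base form a dense open set, so
  Baire's theorem applies.
\<close>

lemma transitive_point_exists:
  fixes X :: "'a::metric_space set"
  assumes X: "tds X T" and tr: "transitive X T"
  obtains x where "x \<in> X" "X \<subseteq> closure (range (\<lambda>n. (T ^^ n) x))"
proof -
  have cX: "compact X" "X \<noteq> {}" using X by (auto simp: tds_def)
  obtain B :: "nat \<Rightarrow> 'a set"
    where B: "\<And>k. openin (top_of_set X) (B k)" "\<And>k. B k \<noteq> {}"
      "\<And>U. openin (top_of_set X) U \<Longrightarrow> U \<noteq> {} \<Longrightarrow> \<exists>k. B k \<subseteq> U"
    using countable_pi_base[OF cX] by metis
  define G where "G k = {x \<in> X. \<exists>n. (T ^^ n) x \<in> B k}" for k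
  have G: "openin (top_of_set X) (G k) \<and> top_of_set X closure_of G k = topspace (top_of_set X)" for k
  proof
    have "G k = (\<Union>n. {x \<in> X. (T ^^ n) x \<in> B k})" by (auto simp: G_def)
    then show "openin (top_of_set X) (G k)"
      using openin_visiting[OF X B(1)] by auto
    have "G k \<inter> U \<noteq> {}" if U: "openin (top_of_set X) U" "U \<noteq> {}" for U
    proof -
      obtain n u where "u \<in> U" "(T ^^ n) u \<in> B k"
        using transitiveD[OF tr U B(1,2)] by blast
      moreover then have "u \<in> X" using U(1) openin_imp_subset by blast
      ultimately show ?thesis by (auto simp: G_def)
    qed
    then show "top_of_set X closure_of G k = topspace (top_of_set X)"
      unfolding dense_intersects_open by blast
  qed
  have "top_of_set X closure_of \<Inter>(range G) = topspace (top_of_set X)"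
  proof (rule Baire_category)
    have "compact_space (top_of_set X)"
      using cX by (simp add: compact_space_subtopology)
    moreover have "Hausdorff_space (top_of_set X)"
      by (simp add: Hausdorff_space_subtopology)
    ultimately show "completely_metrizable_space (top_of_set X) \<or>
        locally_compact_space (top_of_set X) \<and> regular_space (top_of_set X)"
      by (simp add: compact_Hausdorff_imp_regular_space compact_imp_locally_compact_space)
  qed (use G in auto)
  then obtain x where x: "x \<in> \<Inter>(range G)"
    using cX(2) by (metis closure_of_empty ex_in_conv topspace_euclidean_subtopology)
  show thesis
  proof (rule that)
    show "x \<in> X" using x by (auto simp: G_def)
    show "X \<subseteq> closure (range (\<lambda>n. (T ^^ n) x))"
    proof
      fix y assume y: "y \<in> X"
      have "\<exists>z\<in>range (\<lambda>n. (T ^^ n) x). dist z y < e" if "e > 0" for e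
      proof -
        have "openin (top_of_set X) (X \<inter> ball y e)" "X \<inter> ball y e \<noteq> {}"
          using y that by (auto intro!: exI[of _ y])
        then obtain k where k: "B k \<subseteq> X \<inter> ball y e" using B(3) by blast
        obtain n where "(T ^^ n) x \<in> B k" using x by (auto simp: G_def)
        with k have "dist ((T ^^ n) x) y < e" by (auto simp: dist_commute)
        then show ?thesis by blast
      qed
      then show "y \<in> closure (range (\<lambda>n. (T ^^ n) x))" by (simp add: closure_approachable)
    qed
  qed
qed

lemma continuous_image_closure_compact:
  fixes X :: "'a::metric_space set" and f :: "'a \<Rightarrow> 'b::metric_space"
  assumes "compact X" "continuous_on X f" "A \<subseteq> X"
  shows "f ` closure A = closure (f ` A)"
proof
  have sub: "closure A \<subseteq> X"
    using assms(1,3) by (simp add: closure_minimal compact_imp_closed)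
  then have cont: "continuous_on (closure A) f"
    using assms(2) continuous_on_subset by blast
  show "f ` closure A \<subseteq> closure (f ` A)"
    by (rule image_closure_subset[OF cont]) (auto intro: closure_subset[THEN subsetD])
  have "compact (f ` closure A)"
    using assms(1) sub cont compact_Int_closed[of X "closure A"]
    by (simp add: Int_absorb1 compact_continuous_image)
  then show "closure (f ` A) \<subseteq> f ` closure A"
    by (intro closure_minimal image_mono closure_subset compact_imp_closed)
qed

lemma funpow_mult_apply:
  fixes T :: "'a \<Rightarrow> 'a"
  shows "((T ^^ d) ^^ n) x = (T ^^ (d * n)) x"
  by (simp add: funpow_mult)

text \<open>
  Let \<open>x\<close> have a dense orbit and let \<open>A i\<close> be the closure of the \<open>T\<^sup>d\<close>-orbit of \<open>T\<^sup>i x\<close>.  Then \<open>T\<close>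
  maps \<open>A i\<close> onto \<open>A (i + 1)\<close>, and \<open>A (i + d) \<subseteq> A i\<close>.  As \<open>X\<close> is perfect, \<open>x\<close> also lies in the
  closure of each tail of its orbit, so \<open>x \<in> A q\<close> and hence \<open>A 0 \<subseteq> A q\<close> for some \<open>q \<ge> d\<close>.
  Applying \<open>T\<^sup>q\<close> repeatedly gives \<open>A 0 \<subseteq> A q \<subseteq> A (2 q) \<subseteq> \<dots> \<subseteq> A (d q) \<subseteq> A d\<close>.  Thus \<open>A d = A 0\<close>:
  the map \<open>T\<^sup>d\<close> is onto on \<open>A 0\<close>, and \<open>x\<close> visits each open subset of \<open>A 0\<close> again and again.
\<close>

lemma power_decomposition:
  fixes X :: "'a::metric_space set"
  assumes X: "tds X T" "no_isolated_points X" and tr: "transitive X T" and d: "d \<ge> 1"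
  obtains X0 where "X0 \<subseteq> X" "closed X0" "tds X0 (T ^^ d)" "no_isolated_points X0"
    "transitive X0 (T ^^ d)" "X = (\<Union>j<d. (T ^^ j) ` X0)"
proof -
  have cX: "compact X" using X by (simp add: tds_def)
  obtain x where x: "x \<in> X" "X \<subseteq> closure (range (\<lambda>n. (T ^^ n) x))"
    using transitive_point_exists[OF X(1) tr] by metis
  define O' where "O' i = range (\<lambda>n. (T ^^ (d * n + i)) x)" for i
  define A where "A i = closure (O' i)" for i
  have orb: "(T ^^ n) x \<in> X" for n by (rule tds_funpow_in[OF X(1) x(1)])
  have inO: "(T ^^ (d * n + i)) x \<in> O' i" for n i
    unfolding O'_def by (rule rangeI)
  have inA: "(T ^^ (d * n + i)) x \<in> A i" for n i
    unfolding A_def by (rule closure_subset[THEN subsetD, OF inO])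
  have OX: "O' i \<subseteq> X" for i using orb by (auto simp: O'_def)
  have AX: "A i \<subseteq> X" for i
    unfolding A_def using OX cX by (simp add: closure_minimal compact_imp_closed)
  have clA: "closed (A i)" for i by (simp add: A_def)
  have cA: "compact (A i)" for i
    using cX AX clA by (metis compact_Int_closed inf.absorb_iff2)
  have funpow_plus: "(T ^^ j) ((T ^^ i) x) = (T ^^ (i + j)) x" for i j
    by (metis add.commute comp_apply funpow_add)
  have imO: "(T ^^ j) ` O' i = O' (i + j)" for i j
    by (simp add: O'_def image_image funpow_plus add.assoc)
  have imA: "(T ^^ j) ` A i = A (i + j)" for i j
    unfolding A_def imO[symmetric]
    by (rule continuous_image_closure_compact[OF cX tds_continuous_funpow[OF X(1)] OX])
  have shift: "A (i + d * a) \<subseteq> A i" for i a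
    unfolding A_def
  proof (rule closure_mono)
    have "(T ^^ (d * n + (i + d * a))) x \<in> O' i" for n
      using inO[of "n + a" i] by (simp add: algebra_simps)
    then show "O' (i + d * a) \<subseteq> O' i"
      unfolding O'_def[of "i + d * a"] by blast
  qed
  have cover: "X \<subseteq> (\<Union>j<d. A (i + j))" for i
  proof -
    let ?tail = "{y. \<exists>n\<ge>i. y = (T ^^ n) x}"
    have "range (\<lambda>n. (T ^^ n) x) \<subseteq> ?tail \<union> (\<lambda>n. (T ^^ n) x) ` {..<i}"
    proof (rule image_subsetI)
      fix n
      show "(T ^^ n) x \<in> ?tail \<union> (\<lambda>n. (T ^^ n) x) ` {..<i}"
      proof (cases "n < i")
        case False
        then have "(T ^^ n) x \<in> ?tail" by (intro CollectI exI[of _ n]) simp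
        then show ?thesis by (rule UnI1)
      qed blast
    qed
    then have "closure (range (\<lambda>n. (T ^^ n) x)) \<subseteq> closure (?tail \<union> (\<lambda>n. (T ^^ n) x) ` {..<i})"
      by (rule closure_mono)
    then have fin: "X \<subseteq> closure ?tail \<union> (\<lambda>n. (T ^^ n) x) ` {..<i}"
      using x(2) by (simp add: closure_Un finite_imp_closed)
    have "X \<subseteq> closure ?tail"
    proof
      fix y assume y: "y \<in> X"
      then have "y islimpt closure ?tail \<union> (\<lambda>n. (T ^^ n) x) ` {..<i}"
        using X(2) fin islimpt_subset unfolding no_isolated_points_def by blast
      then have "y islimpt closure ?tail"
        by (simp add: islimpt_Un islimpt_finite)
      then show "y \<in> closure ?tail" by (simp add: closed_limpt[THEN iffD1])
    qed
    also have "\<dots> \<subseteq> (\<Union>j<d. A (i + j))"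
    proof (rule closure_minimal)
      show "closed (\<Union>j<d. A (i + j))" using clA by (intro closed_UN) auto
      show "?tail \<subseteq> (\<Union>j<d. A (i + j))"
      proof
        fix y assume "y \<in> ?tail"
        then obtain n where n: "i \<le> n" and y: "y = (T ^^ n) x" by blast
        have "d * ((n - i) div d) + (i + (n - i) mod d) = n"
          using n mult_div_mod_eq[of d "n - i"] by linarith
        then have "y \<in> A (i + (n - i) mod d)"
          unfolding y using inA[of "(n - i) div d" "i + (n - i) mod d"] by simp
        moreover have "(n - i) mod d < d" using d by simp
        ultimately show "y \<in> (\<Union>j<d. A (i + j))" by blast
      qed
    qed
    finally show ?thesis .
  qed
  have "\<exists>q\<ge>d. x \<in> A q"
  proof -
    obtain j where "x \<in> A (d + j)" using cover[of d] x(1) by blast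
    then show ?thesis by (intro exI[of _ "d + j"]) simp
  qed
  then obtain q where q: "q \<ge> d" "x \<in> A q" by blast
  have inv: "((T ^^ d) ^^ n) ` A i \<subseteq> A i" for n i
    using imA[where i = i and j = "d * n"] shift[of i n] by (simp add: funpow_mult)
  have "O' 0 \<subseteq> A q"
  proof -
    have "(T ^^ (d * n)) x \<in> A q" for n
      using inv[of n q] q(2) by (auto simp: funpow_mult_apply)
    then show ?thesis unfolding O'_def by auto
  qed
  then have A0q: "A 0 \<subseteq> A q" unfolding A_def[of 0] by (simp add: closure_minimal clA)
  have "A 0 \<subseteq> A (q * a)" for a
  proof (induction a)
    case (Suc a)
    have "A q \<subseteq> A (q * a + q)"
      using image_mono[OF Suc, of "T ^^ q"] by (simp add: imA)
    with A0q show ?case by (simp add: add.commute)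
  qed simp
  then have "A 0 \<subseteq> A (q * d)" .
  also have "A (q * d) = A (d + d * (q - 1))"
    using q(1) d by (cases q) (simp_all add: mult.commute)
  also have "\<dots> \<subseteq> A d" by (rule shift)
  finally have "A 0 \<subseteq> A d" .
  moreover have "A d \<subseteq> A 0" using shift[of 0 1] by simp
  ultimately have Ad: "A d = A 0" by (intro subset_antisym)
  have Ada: "A (d * a) = A 0" for a
  proof (induction a)
    case (Suc a)
    have "A (d * a + d) = (T ^^ d) ` A (d * a)" by (simp add: imA)
    also have "\<dots> = A d" using Suc imA[where i = 0 and j = d] by simp
    finally show ?case using Ad by (simp add: add.commute)
  qed simp
  have dense: "\<exists>n\<ge>a. (T ^^ (d * n)) x \<in> U" if U: "openin (top_of_set (A 0)) U" "U \<noteq> {}" for U a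
  proof -
    obtain W where W: "open W" "U = A 0 \<inter> W" using U(1) by (auto simp: openin_open)
    then have "W \<inter> closure (O' (d * a)) \<noteq> {}"
      using U(2) Ada[of a] by (auto simp: A_def)
    then obtain y where "y \<in> W" "y \<in> O' (d * a)"
      using W(1) open_Int_closure_eq_empty by blast
    then obtain n where n: "(T ^^ (d * n + d * a)) x \<in> W" by (auto simp: O'_def)
    have "(T ^^ (d * (n + a))) x \<in> A 0" using inA[of "n + a" 0] by simp
    with n W show ?thesis by (intro exI[of _ "n + a"]) (simp add: distrib_left)
  qed
  have tdsA: "tds (A 0) (T ^^ d)"
    unfolding tds_def
  proof (intro conjI)
    show "A 0 \<noteq> {}" by (simp add: A_def O'_def)
    show "continuous_on (A 0) (T ^^ d)"
      using tds_continuous_funpow[OF X(1)] AX continuous_on_subset by blast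
    show "(T ^^ d) ` A 0 = A 0" using imA[where i = 0 and j = d] Ad by simp
  qed (rule cA)
  have trA: "transitive (A 0) (T ^^ d)"
    unfolding transitive_def
  proof (intro allI impI)
    fix U V assume UV: "openin (top_of_set (A 0)) U \<and> U \<noteq> {} \<and> openin (top_of_set (A 0)) V \<and> V \<noteq> {}"
    obtain a where a: "(T ^^ (d * a)) x \<in> U" using dense[of U 0] UV by blast
    obtain b where b: "b \<ge> a" "(T ^^ (d * b)) x \<in> V" using dense[of V a] UV by blast
    have "((T ^^ d) ^^ (b - a)) ((T ^^ (d * a)) x) = (T ^^ (d * b)) x"
      using b(1) by (simp add: funpow_mult_apply funpow_plus flip: distrib_left)
    with b(2) have "(T ^^ (d * a)) x \<in> ((T ^^ d) ^^ (b - a)) -` V" by simp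
    with a show "\<exists>n. U \<inter> ((T ^^ d) ^^ n) -` V \<noteq> {}" by blast
  qed
  have X_eq: "X = (\<Union>j<d. (T ^^ j) ` A 0)"
    using cover[of 0] AX by (auto simp: imA)
  \<comment> \<open>An isolated point of \<open>A 0\<close> would be visited twice by the orbit of \<open>x\<close>, which would make
    this orbit, and with it \<open>X\<close>, finite.\<close>
  have "no_isolated_points (A 0)"
    unfolding no_isolated_points_def
  proof (rule ballI, rule ccontr)
    fix z assume z: "z \<in> A 0" "\<not> z islimpt A 0"
    then obtain W where W: "open W" "z \<in> W" "A 0 \<inter> W \<subseteq> {z}"
      unfolding islimpt_def by blast
    then have oz: "openin (top_of_set (A 0)) {z}"
      using z(1) by (metis Int_iff empty_subsetI insert_subset openin_open subset_antisym)
    obtain a where a: "(T ^^ (d * a)) x = z" using dense[OF oz, of 0] by auto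
    obtain b where b: "b \<ge> Suc a" "(T ^^ (d * b)) x = z" using dense[OF oz, of "Suc a"] by auto
    define c where "c = d * b - d * a"
    have ab: "d * a < d * b" using b(1) d by auto
    then have c: "c > 0" "(T ^^ c) z = z"
      using a b(2) funpow_plus[of c "d * a"] by (auto simp: c_def)
    have "range (\<lambda>n. (T ^^ n) x) \<subseteq> (\<lambda>n. (T ^^ n) x) ` {..<d * a} \<union> (\<lambda>n. (T ^^ n) z) ` {..<c}"
    proof clarify
      fix n assume n: "(T ^^ n) x \<notin> (\<lambda>n. (T ^^ n) z) ` {..<c}"
      have "n < d * a"
      proof (rule ccontr)
        assume "\<not> n < d * a"
        then have "(T ^^ n) x = (T ^^ (n - d * a)) z"
          using a funpow_plus[of "n - d * a" "d * a"] by simp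
        also have "\<dots> = (T ^^ ((n - d * a) mod c)) z"
          using c(2) by (simp add: funpow_mod_eq)
        finally show False using n c(1) by auto
      qed
      then show "(T ^^ n) x \<in> (\<lambda>n. (T ^^ n) x) ` {..<d * a}" by blast
    qed
    then have fin: "finite (range (\<lambda>n. (T ^^ n) x))"
      by (rule finite_subset) auto
    then have "finite X"
      using x(2) by (metis closure_closed finite_imp_closed finite_subset)
    then show False
      using X(2) x(1) islimpt_finite unfolding no_isolated_points_def by blast
  qed
  then show thesis
    using that[of "A 0"] AX clA tdsA trA X_eq by blast
qed

text \<open>
  If \<open>p\<close> lies in the \<open>j\<close>-th image of \<open>X0\<close>, then \<open>d - j\<close> further steps along its periodic
  orbit lead back into \<open>X0\<close>.
\<close>

lemma periodic_point_meets_decomposition: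
  assumes X0: "tds X0 (T ^^ d)" and "X = (\<Union>j<d. (T ^^ j) ` X0)"
    and p: "p \<in> X" "(T ^^ d) p = p"
  obtains p0 where "p0 \<in> X0" "(T ^^ d) p0 = p0"
proof -
  obtain j y where y: "j < d" "y \<in> X0" "p = (T ^^ j) y"
    using assms by blast
  define p0 where "p0 = (T ^^ (d - j)) p"
  have "p0 = (T ^^ d) y"
    using y by (simp add: p0_def flip: funpow_add comp_apply[of "T ^^ (d - j)"])
  then have "p0 \<in> X0" using X0 y(2) by (auto simp: tds_def)
  moreover have "(T ^^ d) p0 = p0"
    unfolding p0_def using p(2) by (metis add.commute comp_apply funpow_add)
  ultimately show thesis by (rule that)
qed

text \<open>
  Every time \<open>n\<close> of \<open>T\<^sup>d\<close> is the time \<open>d * n\<close> of \<open>T\<close>; positivity of \<open>d\<close> keeps the return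
  times increasing.
\<close>

lemma uniformly_chaotic_set_power:
  assumes K: "uniformly_chaotic_set X0 (T ^^ d) K" and "d \<ge> 1" "X0 \<subseteq> X"
  shows "uniformly_chaotic_set X T K"
proof -
  have rig: "rigid T K" if r: "rigid (T ^^ d) K" for K
  proof -
    obtain n where n: "strict_mono n" "\<And>x. x \<in> K \<Longrightarrow> (\<lambda>k. ((T ^^ d) ^^ n k) x) \<longlonglongrightarrow> x"
      using r unfolding rigid_def by blast
    have "strict_mono (\<lambda>k. d * n k)"
      using n(1) \<open>d \<ge> 1\<close> by (auto simp: strict_mono_def)
    with n(2) show ?thesis
      unfolding rigid_def by (auto simp: funpow_mult intro!: exI[of _ "\<lambda>k. d * n k"])
  qed
  have urig: "uniformly_rigid T K" if u: "uniformly_rigid (T ^^ d) K" for K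
    unfolding uniformly_rigid_def
  proof (intro allI impI)
    fix \<epsilon> :: real assume "\<epsilon> > 0"
    then obtain n where "n \<ge> 1" "\<forall>x\<in>K. dist (((T ^^ d) ^^ n) x) x < \<epsilon>"
      using u unfolding uniformly_rigid_def by blast
    then show "\<exists>n\<ge>1. \<forall>x\<in>K. dist ((T ^^ n) x) x < \<epsilon>"
      using \<open>d \<ge> 1\<close> by (intro exI[of _ "d * n"]) (auto simp: funpow_mult)
  qed
  have uprox: "uniformly_proximal T K" if "uniformly_proximal (T ^^ d) K" for K
    using that unfolding uniformly_proximal_def funpow_mult by blast
  then have prox: "proximal T K" if "proximal (T ^^ d) K" for K
    using that unfolding proximal_def by blast
  obtain C where C: "K \<subseteq> X0" "\<And>N. cantor_set (C N)" "\<And>N. C N \<subseteq> C (Suc N)" "K = (\<Union>N. C N)"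
      "rigid (T ^^ d) K" "proximal (T ^^ d) K"
      "\<And>N. uniformly_rigid (T ^^ d) (C N)" "\<And>N. uniformly_proximal (T ^^ d) (C N)"
    using K unfolding uniformly_chaotic_set_def by metis
  show ?thesis
    unfolding uniformly_chaotic_set_def
  proof (intro conjI exI[of _ C] allI)
    show "K \<subseteq> X" using C(1) \<open>X0 \<subseteq> X\<close> by blast
    show "rigid T K" by (rule rig[OF C(5)])
    show "proximal T K" by (rule prox[OF C(6)])
    show "uniformly_rigid T (C N)" for N by (rule urig[OF C(7)])
    show "uniformly_proximal T (C N)" for N by (rule uprox[OF C(8)])
  qed (fact C)+
qed

section \<open>Sufficient conditions for uniform chaos\<close>

theorem corollary3p2:
  fixes X :: "'a::metric_space set" and T :: "'a \<Rightarrow> 'a"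
  assumes "tds X T" and "no_isolated_points X"
  shows
    "(transitive X T \<and> has_fixed_point X T \<longrightarrow> densely_uniformly_chaotic X T) \<and>
     (totally_transitive X T \<and> has_periodic_point X T \<longrightarrow> densely_uniformly_chaotic X T) \<and>
     (scattering X T \<longrightarrow> densely_uniformly_chaotic X T) \<and>
     (weakly_scattering X T \<and> (\<exists>M. minimal_subset X T M \<and> equicontinuous M T) \<longrightarrow>
        densely_uniformly_chaotic X T) \<and>
     (weakly_mixing X T \<longrightarrow> densely_uniformly_chaotic X T) \<and>
     (\<forall>d. transitive X T \<and> has_periodic_point_of_order X T d \<longrightarrow>
        (\<exists>X0. X0 \<subseteq> X \<and> closed X0 \<and> tds X0 (T ^^ d) \<and>
              densely_uniformly_chaotic X0 (T ^^ d) \<and>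
              X = (\<Union>j\<in>{0..d - 1}. (T ^^ j) ` X0)) \<and>
        uniformly_chaotic X T)"
proof (intro conjI impI allI)
  note main = densely_uniformly_chaotic_if_weakly_disjoint_subsystem[OF assms]
  show "densely_uniformly_chaotic X T" if "transitive X T \<and> has_fixed_point X T"
    using that densely_uniformly_chaotic_if_fixed_point[OF assms]
    unfolding has_fixed_point_def by blast
  show "densely_uniformly_chaotic X T" if tt: "totally_transitive X T \<and> has_periodic_point X T"
  proof -
    obtain p n where p: "p \<in> X" "n \<ge> 1" "(T ^^ n) p = p"
      using tt unfolding has_periodic_point_def by blast
    note Y = periodic_orbit_system[OF assms(1) p]
    show ?thesis
    proof (rule main)
      show "tds (range (\<lambda>k. (T ^^ k) p)) T"
        using Y(1) unfolding periodic_system_def by blast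
      show "range (\<lambda>k. (T ^^ k) p) \<subseteq> X" by (rule Y(2))
      show "weakly_disjoint X T (range (\<lambda>k. (T ^^ k) p)) T"
        using totally_transitive_weakly_disjoint[OF assms(1) _ Y(1)] tt by blast
    qed
  qed
  show "densely_uniformly_chaotic X T" if sc: "scattering X T"
  proof -
    obtain M where "minimal_subset X T M"
      using minimal_subset_exists[OF assms(1)] .
    then have M: "M \<subseteq> X" "minimal_system M T" by (auto simp: minimal_subset_def)
    then have "tds M T" by (simp add: minimal_system_def)
    then show ?thesis
      using main M(1) scattering_weakly_disjoint[OF assms(1) sc M(2)] by blast
  qed
  show "densely_uniformly_chaotic X T"
    if ws: "weakly_scattering X T \<and> (\<exists>M. minimal_subset X T M \<and> equicontinuous M T)"
  proof -
    obtain M where M: "M \<subseteq> X" "minimal_system M T" "equicontinuous M T"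
      using ws by (auto simp: minimal_subset_def)
    then have "tds M T" by (simp add: minimal_system_def)
    then show ?thesis
      using main M weakly_scattering_weakly_disjoint[OF assms(1) _ M(2,3)] ws by blast
  qed
  show "densely_uniformly_chaotic X T" if "weakly_mixing X T"
    using that main[OF assms(1)] by (simp add: weakly_mixing_def weakly_disjoint_def)
  fix d assume "transitive X T \<and> has_periodic_point_of_order X T d"
  then obtain p where tr: "transitive X T" and d: "d \<ge> 1" and p: "p \<in> X" "(T ^^ d) p = p"
    unfolding has_periodic_point_of_order_def by blast
  obtain X0 where X0: "X0 \<subseteq> X" "closed X0" "tds X0 (T ^^ d)" "no_isolated_points X0"
    "transitive X0 (T ^^ d)" "X = (\<Union>j<d. (T ^^ j) ` X0)"
    using power_decomposition[OF assms tr d] .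
  obtain p0 where "p0 \<in> X0" "(T ^^ d) p0 = p0"
    using periodic_point_meets_decomposition[OF X0(3,6) p] .
  then have duc: "densely_uniformly_chaotic X0 (T ^^ d)"
    using densely_uniformly_chaotic_if_fixed_point X0 by blast
  have "{0..d - 1} = {..<d}" using d by auto
  then show "\<exists>X0. X0 \<subseteq> X \<and> closed X0 \<and> tds X0 (T ^^ d) \<and>
      densely_uniformly_chaotic X0 (T ^^ d) \<and> X = (\<Union>j\<in>{0..d - 1}. (T ^^ j) ` X0)"
    using X0 duc by (intro exI[of _ X0]) simp
  show "uniformly_chaotic X T"
    using duc uniformly_chaotic_set_power[OF _ d X0(1)]
    unfolding densely_uniformly_chaotic_def uniformly_chaotic_def by blast
qed

end
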